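(* Let $L$ be an even positive definite lattice of rank $l$ containing a sublattice isometric to $\bigoplus_{j=1}^lA_1(d_j)$, where $d_1,\dots,d_l$ are positive integers with $d_i\le d_j$ for $1\le i<j\le l$. Then the minimal slope bound for symmetric formal Fourier–Jacobi series on $\widetilde{\mathrm O}^+(2U\oplus L)$ satisfies $$\varrho_L\ \ge\ 3\cdot2^{3-2^l}\cdot\prod_{j=1}^ld_j^{-2^{j-1}}.$$
   Context: $L$ has form $\langle\cdot,\cdot\rangle$, dual $L'$; $A_1(d)$ is $\mathbb Z$ with form $2dx^2$. $J_{k,L,m}$ is the space of holomorphic Jacobi forms of weight $k$, index $m$, trivial character on $\mathrm{SL}_2(\mathbb Z)$ for $L$: holomorphic $\varphi$ on $\mathbb H\times(L\otimes\mathbb C)$ with $(c\tau+d)^{-k}e^{-\pi im\frac{c\langle\mathfrak z,\mathfrak z\rangle}{c\tau+d}}\varphi(\frac{a\tau+b}{c\tau+d},\frac{\mathfrak z}{c\tau+d})=\varphi(\tau,\mathfrak z)$ for $\begin{pmatrix}a&b\\c&d\end{pmatrix}\in\mathrm{SL}_2(\mathbb Z)$, $e^{\pi im(\langle x,x\rangle\tau+2\langle x,\mathfrak z\rangle)}\varphi(\tau,\mathfrak z+x\tau+y)=\varphi(\tau,\mathfrak z)$ for $x,y\in L$, and $\varphi=\sum_{n\in\mathbb N,\ell\in L'}f(n,\ell)q^n\zeta^\ell$ ($q=e^{2\pi i\tau}$, $\zeta^\ell=e^{2\pi i\langle\ell,\mathfrak z\rangle}$) with $f(n,\ell)=0$ unless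 $2nm\ge\langle\ell,\ell\rangle$. $\widetilde{\mathrm O}(L)=\{g\in\mathrm O(L): g(v)-v\in L\ \forall v\in L'\}$ acts on $\mathfrak z$, and $J^{\widetilde{\mathrm O}(L)}_{k,L,m}$ is the subspace of $\widetilde{\mathrm O}(L)$-invariant forms. A symmetric formal Fourier–Jacobi series of weight $k\ge1$ on $\widetilde{\mathrm O}^+(2U\oplus L)$ ($U$ the even unimodular lattice of signature $(1,1)$) is a formal series $\Psi=\sum_{m\ge0}\psi_m(\tau,\mathfrak z)\xi^m$ with $\psi_m=\sum f_m(n,\ell)q^n\zeta^\ell\in J^{\widetilde{\mathrm O}(L)}_{k,L,m}$ and $f_m(n,\ell)=f_n(m,\ell)$ for all $m,n\in\mathbb N,\ell\in L'$; their space is $\mathbf{FM}_k(\widetilde{\mathrm O}^+(2U\oplus L))$. For $\Psi\ne0$, $\mathrm{ord}(\Psi)=\min\{m:\psi_m\ne0\}$ and the slope is $\varrho(\Psi)=k/\mathrm{ord}(\Psi)$. $\varrho_L=\inf\{\varrho(\Psi):\Psi\in\mathbf{FM}_k(\widetilde{\mathrm O}^+(2U\oplus L)),\Psi\neq0,k\ge1\}$. *)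

theory Defs
  imports "HOL-Analysis.Analysis"
begin

section \<open>Even positive definite lattices\<close>

text \<open>
  A positive definite lattice of rank \<open>l = CARD('n)\<close> is realised as a full-rank lattice
  in the Euclidean space \<open>real ^ 'n\<close>, its form being the restriction of the inner product.
  Thus \<open>L \<otimes> R\<close> is \<open>real ^ 'n\<close> and \<open>L \<otimes> C\<close> is \<open>complex ^ 'n\<close>.
\<close>

definition full_lattice :: "(real ^ 'n) set \<Rightarrow> bool" where
  "full_lattice L \<longleftrightarrow>
     (\<exists>B. independent B \<and> span B = UNIV \<and> L = range (\<lambda>c :: real ^ 'n \<Rightarrow> int. \<Sum>b\<in>B. of_int (c b) *\<^sub>R b))"

definition even_lattice :: "(real ^ 'n) set \<Rightarrow> bool" where
  "even_lattice L \<longleftrightarrow> full_lattice L \<and> (\<forall>x\<in>L. \<exists>N::int. x \<bullet> x = 2 * of_int N)"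

definition dual_lattice :: "(real ^ 'n) set \<Rightarrow> (real ^ 'n) set" where
  "dual_lattice L = {v. \<forall>x\<in>L. v \<bullet> x \<in> \<int>}"

definition A1_form :: "nat \<Rightarrow> int \<Rightarrow> int \<Rightarrow> int" where
  "A1_form d x y = 2 * int d * x * y"

text \<open>The direct sum of \<open>A\<^sub>1(d\<^sub>1), \<dots>, A\<^sub>1(d\<^sub>l)\<close>: integer vectors indexed by \<open>{1..l}\<close>
  (extended by 0), with the orthogonal sum of the forms.\<close>

definition A1_sum_carrier :: "nat \<Rightarrow> (nat \<Rightarrow> int) set" where
  "A1_sum_carrier l = {x. \<forall>j. j \<notin> {1..l} \<longrightarrow> x j = 0}"

definition A1_sum_form :: "nat \<Rightarrow> (nat \<Rightarrow> nat) \<Rightarrow> (nat \<Rightarrow> int) \<Rightarrow> (nat \<Rightarrow> int) \<Rightarrow> int" where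
  "A1_sum_form l d x y = (\<Sum>j=1..l. A1_form (d j) (x j) (y j))"

definition contains_A1_sum :: "(real ^ 'n) set \<Rightarrow> nat \<Rightarrow> (nat \<Rightarrow> nat) \<Rightarrow> bool" where
  "contains_A1_sum L l d \<longleftrightarrow>
     (\<exists>M h. M \<subseteq> L \<and> bij_betw h (A1_sum_carrier l) M \<and>
        (\<forall>x\<in>A1_sum_carrier l. \<forall>y\<in>A1_sum_carrier l.
           h (\<lambda>j. x j + y j) = h x + h y \<and> h x \<bullet> h y = of_int (A1_sum_form l d x y)))"


section \<open>Complexification and the discriminant kernel\<close>

definition cvec :: "real ^ 'n \<Rightarrow> complex ^ 'n" where
  "cvec x = (\<chi> i. of_real (x $ i))"

text \<open>The \<open>C\<close>-bilinear (not hermitian) extension of the form.\<close>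

definition cform :: "complex ^ 'n \<Rightarrow> complex ^ 'n \<Rightarrow> complex" where
  "cform z w = (\<Sum>i\<in>UNIV. z $ i * w $ i)"

definition complexify :: "(real ^ 'n \<Rightarrow> real ^ 'n) \<Rightarrow> complex ^ 'n \<Rightarrow> complex ^ 'n" where
  "complexify g z = cvec (g (\<chi> i. Re (z $ i))) + \<i> *s cvec (g (\<chi> i. Im (z $ i)))"

text \<open>Isometries of \<open>L\<close> are identified with their linear extensions to \<open>L \<otimes> R\<close>.\<close>

definition lattice_isometries :: "(real ^ 'n) set \<Rightarrow> (real ^ 'n \<Rightarrow> real ^ 'n) set" where
  "lattice_isometries L = {g. orthogonal_transformation g \<and> g ` L = L}"

definition discriminant_kernel :: "(real ^ 'n) set \<Rightarrow> (real ^ 'n \<Rightarrow> real ^ 'n) set" where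
  "discriminant_kernel L = {g \<in> lattice_isometries L. \<forall>v\<in>dual_lattice L. g v - v \<in> L}"


section \<open>Jacobi forms\<close>

text \<open>
  Functions on \<open>H \<times> (L \<otimes> C)\<close> are total functions of which only the values at \<open>Im \<tau> > 0\<close>
  matter; accordingly such a function is zero if it vanishes there.
\<close>

definition vanishes_on_H :: "(complex \<Rightarrow> complex ^ 'n \<Rightarrow> complex) \<Rightarrow> bool" where
  "vanishes_on_H \<phi> \<longleftrightarrow> (\<forall>\<tau> z. Im \<tau> > 0 \<longrightarrow> \<phi> \<tau> z = 0)"

text \<open>Holomorphy in several variables: the (real) derivative exists and is \<open>C\<close>-linear.\<close>

definition holomorphic_on_H :: "(complex \<Rightarrow> complex ^ 'n \<Rightarrow> complex) \<Rightarrow> bool" where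
  "holomorphic_on_H \<phi> \<longleftrightarrow>
     (\<forall>\<tau> z. Im \<tau> > 0 \<longrightarrow>
        (\<exists>D. ((\<lambda>(t, w). \<phi> t w) has_derivative D) (at (\<tau>, z)) \<and>
             (\<forall>u v. D (\<i> * u, \<i> *s v) = \<i> * D (u, v))))"

definition jacobi_modular :: "int \<Rightarrow> nat \<Rightarrow> (complex \<Rightarrow> complex ^ 'n \<Rightarrow> complex) \<Rightarrow> bool" where
  "jacobi_modular k m \<phi> \<longleftrightarrow>
     (\<forall>a b c d :: int. \<forall>\<tau> z. a * d - b * c = 1 \<longrightarrow> Im \<tau> > 0 \<longrightarrow>
        (let j = of_int c * \<tau> + of_int d in
         j powi (- k) * exp (- (of_real pi * \<i> * of_nat m * (of_int c * cform z z / j)))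
           * \<phi> ((of_int a * \<tau> + of_int b) / j) (inverse j *s z) = \<phi> \<tau> z))"

definition jacobi_elliptic ::
    "(real ^ 'n) set \<Rightarrow> nat \<Rightarrow> (complex \<Rightarrow> complex ^ 'n \<Rightarrow> complex) \<Rightarrow> bool" where
  "jacobi_elliptic L m \<phi> \<longleftrightarrow>
     (\<forall>x\<in>L. \<forall>y\<in>L. \<forall>\<tau> z. Im \<tau> > 0 \<longrightarrow>
        exp (of_real pi * \<i> * of_nat m * (of_real (x \<bullet> x) * \<tau> + 2 * cform (cvec x) z))
          * \<phi> \<tau> (z + \<tau> *s cvec x + cvec y) = \<phi> \<tau> z)"

text \<open>\<open>f\<close> is the family of Fourier coefficients of \<open>\<phi>\<close>; only \<open>f n v\<close> with \<open>v\<close> in the dual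
  lattice is meaningful.\<close>

definition jacobi_expansion ::
    "(real ^ 'n) set \<Rightarrow> nat \<Rightarrow> (complex \<Rightarrow> complex ^ 'n \<Rightarrow> complex) \<Rightarrow>
     (nat \<Rightarrow> real ^ 'n \<Rightarrow> complex) \<Rightarrow> bool" where
  "jacobi_expansion L m \<phi> f \<longleftrightarrow>
     (\<forall>\<tau> z. Im \<tau> > 0 \<longrightarrow>
        ((\<lambda>(n, v). f n v * exp (2 * of_real pi * \<i> * \<tau>) ^ n
                       * exp (2 * of_real pi * \<i> * cform (cvec v) z))
          has_sum \<phi> \<tau> z) (UNIV \<times> dual_lattice L)) \<and>
     (\<forall>n. \<forall>v\<in>dual_lattice L. f n v \<noteq> 0 \<longrightarrow> 2 * real n * real m \<ge> v \<bullet> v)"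

definition jacobi_forms ::
    "int \<Rightarrow> (real ^ 'n) set \<Rightarrow> nat \<Rightarrow> (complex \<Rightarrow> complex ^ 'n \<Rightarrow> complex) set" where
  "jacobi_forms k L m =
     {\<phi>. holomorphic_on_H \<phi> \<and> jacobi_modular k m \<phi> \<and> jacobi_elliptic L m \<phi> \<and>
         (\<exists>f. jacobi_expansion L m \<phi> f)}"

definition invariant_jacobi_forms ::
    "int \<Rightarrow> (real ^ 'n) set \<Rightarrow> nat \<Rightarrow> (complex \<Rightarrow> complex ^ 'n \<Rightarrow> complex) set" where
  "invariant_jacobi_forms k L m =
     {\<phi> \<in> jacobi_forms k L m.
        \<forall>g\<in>discriminant_kernel L. \<forall>\<tau> z. Im \<tau> > 0 \<longrightarrow> \<phi> \<tau> (complexify g z) = \<phi> \<tau> z}"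


section \<open>Symmetric formal Fourier--Jacobi series\<close>

text \<open>A formal series \<open>\<Sum>m. \<psi>\<^sub>m \<xi>\<^sup>m\<close> is its sequence of coefficients \<open>\<psi>\<close>.\<close>

definition symmetric_FJ_series ::
    "int \<Rightarrow> (real ^ 'n) set \<Rightarrow> (nat \<Rightarrow> complex \<Rightarrow> complex ^ 'n \<Rightarrow> complex) set" where
  "symmetric_FJ_series k L =
     {\<psi>. (\<forall>m. \<psi> m \<in> invariant_jacobi_forms k L m) \<and>
         (\<exists>f. (\<forall>m. jacobi_expansion L m (\<psi> m) (f m)) \<and>
              (\<forall>m n. \<forall>v\<in>dual_lattice L. f m n v = f n m v))}"

definition FJ_nonzero :: "(nat \<Rightarrow> complex \<Rightarrow> complex ^ 'n \<Rightarrow> complex) \<Rightarrow> bool" where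
  "FJ_nonzero \<psi> \<longleftrightarrow> (\<exists>m. \<not> vanishes_on_H (\<psi> m))"

definition FJ_ord :: "(nat \<Rightarrow> complex \<Rightarrow> complex ^ 'n \<Rightarrow> complex) \<Rightarrow> nat" where
  "FJ_ord \<psi> = (LEAST m. \<not> vanishes_on_H (\<psi> m))"

text \<open>Slopes are extended reals: for \<open>k \<ge> 1\<close> a series of order 0 has slope \<open>\<infinity>\<close>,
  in accordance with \<open>ereal\<close> division.\<close>

definition FJ_slope :: "int \<Rightarrow> (nat \<Rightarrow> complex \<Rightarrow> complex ^ 'n \<Rightarrow> complex) \<Rightarrow> ereal" where
  "FJ_slope k \<psi> = ereal (of_int k) / ereal (real (FJ_ord \<psi>))"

lemma FJ_slope_ord_0: "k \<ge> 1 \<Longrightarrow> FJ_ord \<psi> = 0 \<Longrightarrow> FJ_slope k \<psi> = \<infinity>"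
  by (simp add: FJ_slope_def divide_ereal_def)

definition minimal_slope :: "(real ^ 'n) set \<Rightarrow> ereal" where
  "minimal_slope L =
     Inf {FJ_slope k \<psi> | k \<psi>. k \<ge> 1 \<and> \<psi> \<in> symmetric_FJ_series k L \<and> FJ_nonzero \<psi>}"

end

theory Submission
  imports Defs "HOL-Complex_Analysis.Complex_Analysis" "HOL-Number_Theory.Cong"
    "HOL-Real_Asymp.Real_Asymp"
begin

text \<open>
  Let \<open>m = ord \<Psi> > 0\<close>. By symmetry only the powers \<open>q\<^sup>n\<close> with \<open>n \<ge> m\<close> occur in \<open>\<phi> = \<psi>\<^sub>m\<close>.
  For a torsion point \<open>z = \<tau>a + b\<close> the function \<open>exp (\<pi>im\<langle>a,a\<rangle>\<tau>) \<phi>(\<tau>, \<tau>a + b)\<close> depends, up to a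
  constant of modulus 1, only on \<open>(a, b)\<close> modulo \<open>L\<close>, and \<open>SL\<^sub>2(\<int>)\<close> permutes these functions with
  weight \<open>k\<close>. Since \<open>n + \<langle>v,a\<rangle> + m\<langle>a,a\<rangle>/2 \<ge> (\<surd>n - \<surd>m |a|/\<surd>2)\<^sup>2\<close> whenever \<open>\<langle>v,v\<rangle> \<le> 2nm\<close>, such a
  function vanishes at the cusp to order at least \<open>m (1 - |a|/\<surd>2)\<^sup>2\<close> if \<open>|a| \<le> \<surd>2\<close>.

  Take points whose coordinates along the orthogonal vectors \<open>e\<^sub>1, \<dots>, e\<^sub>l\<close> of \<open>\<Oplus> A\<^sub>1(d\<^sub>j)\<close> have
  distinct large prime denominators \<open>p\<^sub>1, \<dots>, p\<^sub>l\<close>. By the Chinese remainder theorem \<open>SL\<^sub>2(\<int>)\<close> acts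
  transitively on them, so none of the functions vanishes identically, and their product is
  a modular form of weight \<open>k\<close> times the number of points. Siegel's maximum principle argument
  bounds its order at the cusp by the weight divided by \<open>2\<surd>3\<pi>\<close> (slightly worse than 12, but
  sufficient). The average order over the points is bounded below by its value on a box of
  real points as the \<open>p\<^sub>j\<close> tend to infinity.
\<close>

section \<open>Order at the cusp of modular functions\<close>

lemma periodic_int_shift:
  assumes per: "\<And>t. Q (Im t) \<Longrightarrow> f (t + 1) = f t" and t: "Q (Im t)"
  shows "f (t - of_int n) = f t"
proof -
  have *: "f (t + of_nat n) = f t" if "Q (Im t)" for t n
  proof (induction n)
    case (Suc n)
    have "f (t + of_nat (Suc n)) = f ((t + of_nat n) + 1)" by (simp add: algebra_simps)
    then show ?case using per[of "t + of_nat n"] that Suc by simp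
  qed simp
  show ?thesis
    using *[of "t - of_int n" "nat n"] *[of t "nat (- n)"] t by (cases "n \<ge> 0") auto
qed

text \<open>Periodicity confines the search to a strip of width one, and above some height the
  decaying bound \<open>g\<close> lies below \<open>f t1\<close>; a compact rectangle
  remains.\<close>

lemma periodic_attains_max:
  fixes f :: "complex \<Rightarrow> real"
  assumes cont: "continuous_on {t. c \<le> Im t} f"
    and per: "\<And>t. c \<le> Im t \<Longrightarrow> f (t + 1) = f t"
    and bound: "\<And>t. c \<le> Im t \<Longrightarrow> f t \<le> g (Im t)"
    and lim: "(g \<longlongrightarrow> 0) at_top"
    and t1: "c \<le> Im t1" "f t1 > 0"
  obtains t0 where "c \<le> Im t0" "0 < f t0" "\<And>t. c \<le> Im t \<Longrightarrow> f t \<le> f t0"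
proof -
  have iper: "f (t - of_int n) = f t" if "c \<le> Im t" for t n
    using periodic_int_shift[of "\<lambda>y. c \<le> y" f] per that by blast
  obtain Y where Y: "\<And>y. y \<ge> Y \<Longrightarrow> g y < f t1"
    using order_tendstoD(2)[OF lim t1(2)] by (auto simp: eventually_at_top_linorder)
  define K where "K = cbox (Complex 0 c) (Complex 1 (max Y (Im t1)))"
  have fract: "t - of_int \<lfloor>Re t\<rfloor> \<in> K" if "c \<le> Im t" "Im t \<le> max Y (Im t1)" for t
    using that by (auto simp: K_def in_cbox_complex_iff) linarith+
  have "continuous_on K f"
    by (rule continuous_on_subset[OF cont]) (auto simp: K_def in_cbox_complex_iff)
  moreover have "compact K" "K \<noteq> {}"
    using fract[of t1] t1 by (auto simp: K_def)
  ultimately obtain t0 where t0: "t0 \<in> K" "\<And>t. t \<in> K \<Longrightarrow> f t \<le> f t0"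
    using continuous_attains_sup by metis
  have *: "f t \<le> f t0" if "c \<le> Im t" "Im t \<le> max Y (Im t1)" for t
    using t0(2)[OF fract[OF that]] iper that by metis
  have **: "f t \<le> f t0" if "c \<le> Im t" for t
  proof (cases "Im t \<le> max Y (Im t1)")
    case False
    then have "f t < f t1" using bound[OF that] Y[of "Im t"] by linarith
    then show ?thesis using *[of t1] t1 by simp
  qed (use * that in blast)
  have "c \<le> Im t0" using t0(1) by (auto simp: K_def in_cbox_complex_iff)
  then show ?thesis using that[of t0] ** t1 by (meson less_le_trans)
qed

text \<open>The function \<open>h t = |P t| * Im t powr (K/2)\<close> is invariant under
  \<open>t + 1\<close> and \<open>-1/t\<close>. A maximum of \<open>h\<close> at height
  \<open>y0 \<ge> sqrt 3 / 2\<close> bounds \<open>P\<close> from above on the line at height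
  \<open>y1 < y0\<close>, while the maximum modulus principle for \<open>P\<close> divided by
  \<open>exp (2 pi i A' t)\<close> bounds it from below at a point of that line. Together they give
  \<open>4 pi A' y1 \<le> K\<close>, against the choice of \<open>y1\<close>.\<close>

lemma modular_order_bound:
  fixes P :: "complex \<Rightarrow> complex" and K A C :: real
  assumes holo: "P holomorphic_on {t. Im t > 0}"
    and T: "\<And>t. Im t > 0 \<Longrightarrow> cmod (P (t + 1)) = cmod (P t)"
    and S: "\<And>t. Im t > 0 \<Longrightarrow> cmod (P (- 1 / t)) = cmod t powr K * cmod (P t)"
    and growth: "\<And>t. Im t \<ge> 1/2 \<Longrightarrow> cmod (P t) \<le> C * exp (- (2 * pi * A * Im t))"
    and nonzero: "Im t1 \<ge> 1" "P t1 \<noteq> 0"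
    and K: "K \<ge> 0"
  shows "2 * sqrt 3 * pi * A \<le> K"
proof (rule ccontr)
  assume "\<not> ?thesis"
  then have less: "K / (2 * sqrt 3 * pi) < A" by (simp add: field_simps)
  \<comment> \<open>The gap between \<open>A'\<close> and \<open>A\<close> is what makes
    \<open>Q\<close> below still decay at the cusp.\<close>
  then obtain A' where A': "K / (2 * sqrt 3 * pi) < A'" "A' < A"
    using dense by blast
  have "0 \<le> K / (2 * sqrt 3 * pi)" using K by simp
  then have A'pos: "A' > 0" "A > 0" using A' less by linarith+
  define b where "b = 2 * pi * A"
  have bpos: "b > 0" using A'pos by (simp add: b_def)
  have contP: "continuous_on {t. c \<le> Im t} P" if "c > 0" for c
    by (rule holomorphic_on_imp_continuous_on[OF holomorphic_on_subset[OF holo]]) (use that in auto)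
  have s3: "sqrt 3 / 2 \<le> 1" "sqrt 3 / 2 \<ge> 4/5" "sqrt 3 > 0"
    using real_sqrt_le_mono[of 3 4] real_le_rsqrt[of "8/5" 3] by (auto simp: power2_eq_square)
  define h where "h = (\<lambda>t. cmod (P t) * Im t powr (K/2))"
  have hT: "h (t + 1) = h t" if "Im t > 0" for t
    using T[OF that] by (simp add: h_def)
  have hS: "h (- 1 / t) = h t" if "Im t > 0" for t
  proof -
    have t0: "t \<noteq> 0" using that by auto
    have "Im (- 1 / t) = Im t / (cmod t)\<^sup>2"
      by (simp add: Im_divide cmod_def)
    moreover have "(Im t / (cmod t)\<^sup>2) powr (K/2) = Im t powr (K/2) / cmod t powr K"
      using that by (simp add: powr_divide powr_power[symmetric] powr_powr flip: powr_numeral)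
    ultimately show ?thesis using S[OF that] t0 by (simp add: h_def)
  qed
  obtain t0 where t0: "sqrt 3 / 2 \<le> Im t0" "0 < h t0" "\<And>t. sqrt 3 / 2 \<le> Im t \<Longrightarrow> h t \<le> h t0"
  proof (rule periodic_attains_max[of "sqrt 3 / 2" h "\<lambda>y. C * exp (- (b * y)) * y powr (K/2)" t1])
    show "continuous_on {t. sqrt 3 / 2 \<le> Im t} h"
      unfolding h_def using contP[of "sqrt 3 / 2"] s3
      by (intro continuous_intros) auto
    show "((\<lambda>y. C * exp (- (b * y)) * y powr (K/2)) \<longlongrightarrow> 0) at_top"
      using bpos K by real_asymp
    show "h t \<le> C * exp (- (b * Im t)) * Im t powr (K/2)" if "sqrt 3 / 2 \<le> Im t" for t
      unfolding h_def b_def using growth[of t] that s3 by (intro mult_right_mono) auto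
    show "0 < h t1" "sqrt 3 / 2 \<le> Im t1" using nonzero s3 by (auto simp: h_def)
    show "h (t + 1) = h t" if "sqrt 3 / 2 \<le> Im t" for t
      using that s3 by (intro hT) auto
  qed blast
  define y0 where "y0 = Im t0"
  \<comment> \<open>Only points slightly below height \<open>\<surd>3/2\<close> are needed; one translation and one inversion
    lift these above it, so no reduction theory is involved.\<close>
  have hmax: "h t \<le> h t0" if t: "3/5 \<le> Im t" for t
  proof (cases "sqrt 3 / 2 \<le> Im t")
    case False
    define y where "y = Im t"
    have pershift: "h (t - of_int n) = h t" if "Im t > 0" for n t
      using periodic_int_shift[of "\<lambda>y. y > 0" h] hT that by blast
    define t' where "t' = t - of_int (round (Re t))"
    have t': "\<bar>Re t'\<bar> \<le> 1/2" "Im t' = y"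
      using of_int_round_abs_le[of "Re t"] by (auto simp: t'_def y_def abs_minus_commute)
    have ht': "h t' = h t" unfolding t'_def using t by (intro pershift) auto
    \<comment> \<open>\<open>sqrt 3 / 2\<close> and \<open>sqrt 3 / 6\<close> are the solutions
      \<open>y\<close> of \<open>y / (1/4 + y^2) = sqrt 3 / 2\<close>. Between them, inverting a
      point with \<open>|Re| \<le> 1/2\<close> lands at height at least
      \<open>sqrt 3 / 2\<close>.\<close>
    have "(sqrt 3 / 2 - y) * (y - sqrt 3 / 6) \<ge> 0"
      using False t s3 by (intro mult_nonneg_nonneg) (auto simp: y_def)
    then have "sqrt 3 / 2 * ((sqrt 3 / 2 - y) * (y - sqrt 3 / 6)) \<ge> 0"
      using s3 by (simp add: zero_le_mult_iff)
    moreover have "sqrt 3 / 2 * ((sqrt 3 / 2 - y) * (y - sqrt 3 / 6)) =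
        (sqrt 3)\<^sup>2 / 3 * y - sqrt 3 / 2 * ((sqrt 3)\<^sup>2 / 12 + y\<^sup>2)"
      by (simp add: field_simps power2_eq_square)
    ultimately have "sqrt 3 / 2 * (1/4 + y\<^sup>2) \<le> y"
      by simp
    then have "sqrt 3 / 2 \<le> y / (1/4 + y\<^sup>2)"
      by (subst pos_le_divide_eq) (auto intro: add_pos_nonneg)
    also have "\<dots> \<le> y / ((Re t')\<^sup>2 + y\<^sup>2)"
    proof (rule divide_left_mono)
      have "(Re t')\<^sup>2 \<le> (1/2)\<^sup>2" using t'(1) by (metis abs_ge_zero power2_abs power_mono)
      then show "(Re t')\<^sup>2 + y\<^sup>2 \<le> 1/4 + y\<^sup>2" by (simp add: power2_eq_square)
      show "0 \<le> y" using t by (simp add: y_def)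
      have "y > 0" using t by (simp add: y_def)
      then show "0 < (1/4 + y\<^sup>2) * ((Re t')\<^sup>2 + y\<^sup>2)"
        by (intro mult_pos_pos add_pos_pos add_nonneg_pos) auto
    qed
    also have "\<dots> = Im (- 1 / t')"
      by (simp add: Im_divide t'(2))
    finally have "h (- 1 / t') \<le> h t0" by (rule t0(3))
    then show ?thesis using hS[of t'] t' t ht' by (simp add: y_def)
  qed (use t0 in blast)
  \<comment> \<open>The midpoint of \<open>K / (4 pi A')\<close> and \<open>y0\<close>, raised to
    \<open>3/5\<close> if necessary so that \<open>hmax\<close> applies; it stays below
    \<open>y0\<close> because \<open>3/5 < 4/5 \<le> sqrt 3 / 2\<close>.\<close>
  define y1 where "y1 = max (3/5) ((K / (4 * pi * A') + y0) / 2)"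
  have y0: "y0 \<ge> sqrt 3 / 2" using t0 by (simp add: y0_def)
  have "K < 2 * sqrt 3 * pi * A'" using A'(1) by (simp add: field_simps)
  also have "\<dots> = 4 * pi * A' * (sqrt 3 / 2)" by simp
  also have "\<dots> \<le> 4 * pi * A' * y0" using y0 A'pos by (intro mult_left_mono) auto
  finally have less_y0: "K / (4 * pi * A') < y0" using A'pos by (simp add: field_simps)
  define q where "q = K / (4 * pi * A')"
  have "3/5 \<le> y1 \<and> y1 < y0 \<and> q < y1"
    using y0 s3(2) less_y0 unfolding y1_def q_def[symmetric] max_def by auto
  then have y1: "3/5 \<le> y1" "y1 < y0" "K / (4 * pi * A') < y1"
    by (auto simp: q_def)
  define Q where "Q = (\<lambda>t. P t * exp (- (2 * of_real pi * \<i> * of_real A' * t)))"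
  have Qn: "cmod (Q t) = cmod (P t) * exp (2 * pi * A' * Im t)" for t
    by (simp add: Q_def norm_mult)
  have holQ: "Q holomorphic_on {t. y1 < Im t}"
    unfolding Q_def using y1
    by (intro holomorphic_intros holomorphic_on_subset[OF holo]) auto
  have Qb: "cmod (Q t) \<le> C * exp (- (2 * pi * (A - A')) * Im t)" if "1/2 \<le> Im t" for t
  proof -
    have "cmod (Q t) \<le> C * exp (- (2 * pi * A * Im t)) * exp (2 * pi * A' * Im t)"
      unfolding Qn using growth[OF that] by (intro mult_right_mono) auto
    also have "\<dots> = C * exp (- (2 * pi * (A - A')) * Im t)"
      by (simp add: exp_add[symmetric] algebra_simps)
    finally show ?thesis .
  qed
  define a where "a = 2 * pi * (A - A')"
  have apos: "a > 0" using A' by (simp add: a_def)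
  have alim: "((\<lambda>y. C * exp (- a * y)) \<longlongrightarrow> 0) at_top"
    using apos by real_asymp
  have Pt0: "P t0 \<noteq> 0" using t0 by (auto simp: h_def)
  obtain ts where ts: "y1 \<le> Im ts" "0 < cmod (Q ts)" "\<And>t. y1 \<le> Im t \<Longrightarrow> cmod (Q t) \<le> cmod (Q ts)"
  proof (rule periodic_attains_max[of y1 "\<lambda>t. cmod (Q t)" "\<lambda>y. C * exp (- a * y)" t0])
    show "continuous_on {t. y1 \<le> Im t} (\<lambda>t. cmod (Q t))"
      unfolding Q_def using contP[of y1] y1 by (intro continuous_intros) auto
    show "cmod (Q (t + 1)) = cmod (Q t)" if "y1 \<le> Im t" for t
      unfolding Qn using T[of t] that y1 by simp
    show "cmod (Q t) \<le> C * exp (- a * Im t)" if "y1 \<le> Im t" for t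
      using Qb[of t] that y1 by (simp add: a_def)
    show "y1 \<le> Im t0" using y1 by (simp add: y0_def)
    show "0 < cmod (Q t0)" using Pt0 by (simp add: Q_def)
  qed (use alim in blast)+
  \<comment> \<open>An interior maximum would make \<open>Q\<close> a nonzero constant,
    contradicting its decay at the cusp.\<close>
  have "Im ts = y1"
  proof (rule ccontr)
    assume "Im ts \<noteq> y1"
    then have "Im ts > y1" using ts by simp
    then have "Q constant_on {t. y1 < Im t}"
      using ts holQ
      by (intro maximum_modulus_principle[where U = "{t. y1 < Im t}" and \<xi> = ts])
        (auto simp: open_halfspace_Im_gt convex_connected convex_halfspace_Im_gt)
    then obtain q where q: "\<And>t. y1 < Im t \<Longrightarrow> Q t = q"
      by (auto simp: constant_on_def)
    have "eventually (\<lambda>y. C * exp (- a * y) < cmod (Q ts)) at_top"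
      using order_tendstoD(2)[OF alim ts(2)] .
    moreover have "eventually (\<lambda>y. y > y1) at_top" by (rule eventually_gt_at_top)
    ultimately have ev: "eventually (\<lambda>y. C * exp (- a * y) < cmod (Q ts) \<and> y > y1) at_top"
      by (rule eventually_conj)
    obtain y where "C * exp (- a * y) < cmod (Q ts)" "y > y1"
      using eventually_happens'[OF trivial_limit_at_top_linorder ev] by blast
    moreover have "Q (Complex 0 y) = Q ts" using q[of "Complex 0 y"] q[of ts] \<open>Im ts > y1\<close> \<open>y > y1\<close> by simp
    ultimately show False using Qb[of "Complex 0 y"] y1 by (simp add: a_def)
  qed
  have e1: "cmod (P t0) * exp (2 * pi * A' * y0) \<le> cmod (P ts) * exp (2 * pi * A' * y1)"
    using ts(3)[of t0] y1 \<open>Im ts = y1\<close> by (simp add: Qn y0_def)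
  have e2: "cmod (P ts) * y1 powr (K/2) \<le> cmod (P t0) * y0 powr (K/2)"
    using hmax[of ts] y1 \<open>Im ts = y1\<close> by (simp add: h_def y0_def)
  have y1p: "y1 > 0" "y0 > 0" using y1 by linarith+
  have "cmod (P t0) * exp (2 * pi * A' * y0) * y1 powr (K/2)
      \<le> cmod (P ts) * exp (2 * pi * A' * y1) * y1 powr (K/2)"
    using e1 by (intro mult_right_mono) auto
  also have "\<dots> = cmod (P ts) * y1 powr (K/2) * exp (2 * pi * A' * y1)" by simp
  also have "\<dots> \<le> cmod (P t0) * y0 powr (K/2) * exp (2 * pi * A' * y1)"
    using e2 by (intro mult_right_mono) auto
  finally have "cmod (P t0) * (exp (2 * pi * A' * y0) * y1 powr (K/2))
      \<le> cmod (P t0) * (y0 powr (K/2) * exp (2 * pi * A' * y1))" by (simp add: mult_ac)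
  then have "exp (2 * pi * A' * y0) * y1 powr (K/2) \<le> y0 powr (K/2) * exp (2 * pi * A' * y1)"
    using Pt0 by simp
  then have "ln (exp (2 * pi * A' * y0) * y1 powr (K/2)) \<le> ln (y0 powr (K/2) * exp (2 * pi * A' * y1))"
    using y1p by (subst ln_le_cancel_iff) auto
  then have "2 * pi * A' * y0 + K/2 * ln y1 \<le> K/2 * ln y0 + 2 * pi * A' * y1"
    using y1p by (simp add: ln_mult ln_powr)
  then have "2 * pi * A' * (y0 - y1) \<le> K/2 * ln (y0 / y1)"
    using y1p by (simp add: ln_div algebra_simps)
  \<comment> \<open>Linearising the logarithm makes both sides multiples of \<open>y0 - y1\<close>,
    which cancels.\<close>
  also have "\<dots> \<le> K/2 * (y0 / y1 - 1)"
    using K y1p ln_le_minus_one[of "y0 / y1"] by (intro mult_left_mono) auto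
  also have "\<dots> = K / (2 * y1) * (y0 - y1)" using y1p by (simp add: field_simps)
  finally have "2 * pi * A' \<le> K / (2 * y1)"
    by (rule mult_right_le_imp_le) (use y1 in simp)
  then have "4 * pi * A' * y1 \<le> K" using y1p by (simp add: field_simps)
  then show False using y1(3) A'pos by (simp add: field_simps)
qed

section \<open>Jacobi forms at torsion points\<close>

lemma cvec_add: "cvec (x + y) = cvec x + cvec y"
  by (simp add: cvec_def vec_eq_iff)

lemma cvec_minus: "cvec (- x) = - cvec x"
  by (simp add: cvec_def vec_eq_iff)

lemma cform_add_left: "cform (x + y) z = cform x z + cform y z"
  by (simp add: cform_def algebra_simps sum.distrib)

lemma cform_add_right: "cform z (x + y) = cform z x + cform z y"
  by (simp add: cform_def algebra_simps sum.distrib)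

lemma cform_scale_left: "cform (a *s x) y = a * cform x y"
  by (simp add: cform_def sum_distrib_left mult_ac)

lemma cform_scale_right: "cform x (a *s y) = a * cform x y"
  by (simp add: cform_def sum_distrib_left mult_ac)

lemma cform_diff_left: "cform (x - y) z = cform x z - cform y z"
  by (simp add: cform_def algebra_simps sum_subtractf)

lemma cform_diff_right: "cform z (x - y) = cform z x - cform z y"
  by (simp add: cform_def algebra_simps sum_subtractf)

lemma cform_cvec: "cform (cvec x) (cvec y) = of_real (x \<bullet> y)"
  by (simp add: cform_def cvec_def inner_vec_def)

lemmas cform_simps = cform_add_left cform_add_right cform_scale_left cform_scale_right
  cform_diff_left cform_diff_right cform_cvec

definition torus_fun ::
    "(complex \<Rightarrow> complex ^ 'n \<Rightarrow> complex) \<Rightarrow> nat \<Rightarrow> real ^ 'n \<Rightarrow> real ^ 'n \<Rightarrow> complex \<Rightarrow> complex" where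
  "torus_fun \<phi> m a b t =
     exp (of_real pi * \<i> * of_nat m * (of_real (a \<bullet> a) * t)) * \<phi> t (t *s cvec a + cvec b)"

text \<open>Serves to discard the constants of modulus 1 that the transformation laws produce: a
  purely imaginary difference of exponents does not affect the modulus.\<close>

lemma cmod_exp_mult_eqI:
  assumes "x + e = y + \<i> * of_real r"
  shows "cmod (exp x) * cmod (exp e) = cmod (exp y)"
proof -
  have "cmod (exp x) * cmod (exp e) = cmod (exp (x + e))"
    by (simp only: exp_add norm_mult)
  then show ?thesis unfolding assms by simp
qed

text \<open>Complete the square: for \<open>z = t a + b\<close>,
  \<open><a+x,a+x> t - <x,x> t - 2 <x,z> = <a,a> t - 2 <x,b>\<close>, and the last term is
  real.\<close>

lemma torus_fun_shift:
  assumes "jacobi_elliptic L m \<phi>" "x \<in> L" "y \<in> L" "Im t > 0"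
  shows "cmod (torus_fun \<phi> m (a + x) (b + y) t) = cmod (torus_fun \<phi> m a b t)"
proof -
  define z where "z = t *s cvec a + cvec b"
  define E where "E = of_real pi * \<i> * of_nat m * (of_real (x \<bullet> x) * t + 2 * cform (cvec x) z)"
  have z': "t *s cvec (a + x) + cvec (b + y) = z + t *s cvec x + cvec y"
    by (simp add: z_def cvec_add vector_add_ldistrib)
  have "exp E * \<phi> t (z + t *s cvec x + cvec y) = \<phi> t z"
    using assms unfolding jacobi_elliptic_def E_def by blast
  then have "\<phi> t (z + t *s cvec x + cvec y) = exp (- E) * \<phi> t z"
    by (auto simp: exp_minus field_simps)
  moreover have "cmod (exp (of_real pi * \<i> * of_nat m * (of_real ((a + x) \<bullet> (a + x)) * t))) * cmod (exp (- E))
      = cmod (exp (of_real pi * \<i> * of_nat m * (of_real (a \<bullet> a) * t)))"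
    by (rule cmod_exp_mult_eqI[where r = "- 2 * pi * real m * (x \<bullet> b)"])
      (simp add: E_def z_def cform_simps inner_add_left inner_add_right inner_commute algebra_simps)
  ultimately show ?thesis
    unfolding torus_fun_def z' by (simp add: norm_mult mult_ac del: norm_exp_eq_Re flip: z_def)
qed

lemma torus_fun_translate:
  assumes "jacobi_modular k m \<phi>" "Im t > 0"
  shows "cmod (torus_fun \<phi> m a b (t + 1)) = cmod (torus_fun \<phi> m a (b + a) t)"
proof -
  have mod: "\<phi> (t + 1) z = \<phi> t z" for z
    using assms(1)[unfolded jacobi_modular_def, rule_format, where a = 1 and b = 1 and c = 0 and d = 1 and \<tau> = t and z = z] assms(2)
    by simp
  have eq: "(t + 1) *s cvec a + cvec b = t *s cvec a + cvec (b + a)"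
    by (simp add: cvec_add vector_sadd_rdistrib)
  then show ?thesis
    unfolding torus_fun_def mod eq by (simp add: norm_mult)
qed

text \<open>For \<open>z = t b - a\<close> one has \<open>z / t = (-1/t) a + b\<close>, so inversion
  turns the section \<open>(a, b)\<close> into \<open>(b, -a)\<close>. The exponents agree up to a
  real term, as \<open>- <a,a> / t + <z,z> / t = <b,b> t - 2 <a,b>\<close>.\<close>

lemma torus_fun_invert:
  assumes "jacobi_modular k m \<phi>" "Im t > 0"
  shows "cmod (torus_fun \<phi> m a b (- 1 / t)) = cmod t powi k * cmod (torus_fun \<phi> m b (- a) t)"
proof -
  have t: "t \<noteq> 0" using assms by auto
  define z where "z = t *s cvec b + cvec (- a)"
  define E where "E = of_real pi * \<i> * of_nat m * (cform z z / t)"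
  have "t powi (- k) * exp (- E) * \<phi> (- 1 / t) (inverse t *s z) = \<phi> t z"
    using assms(1)[unfolded jacobi_modular_def, rule_format, where a = 0 and b = "-1" and c = 1 and d = 0 and \<tau> = t and z = z] assms(2)
    by (simp add: E_def)
  then have "\<phi> (- 1 / t) (inverse t *s z) = t powi k * (exp E * \<phi> t z)"
    using t by (auto simp: power_int_minus exp_minus field_simps)
  moreover have "inverse t *s z = (- 1 / t) *s cvec a + cvec b"
    using t by (simp add: z_def vec_eq_iff cvec_def field_simps)
  moreover have "cmod (exp (of_real pi * \<i> * of_nat m * (of_real (a \<bullet> a) * (- 1 / t)))) * cmod (exp E)
      = cmod (exp (of_real pi * \<i> * of_nat m * (of_real (b \<bullet> b) * t)))"
    by (rule cmod_exp_mult_eqI[where r = "- 2 * pi * real m * (a \<bullet> b)"])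
      (use t in \<open>simp add: E_def z_def cvec_minus cform_simps inner_commute field_simps\<close>)
  ultimately show ?thesis
    unfolding torus_fun_def
    by (simp add: norm_mult norm_power_int mult_ac del: norm_exp_eq_Re flip: z_def)
qed

text \<open>The real derivative \<open>D\<close> commutes with multiplication by
  \<open>\<i>\<close>, hence is complex linear along the direction \<open>(1, cvec a)\<close> of the
  section; the chain rule then yields a complex derivative.\<close>

lemma holomorphic_torus_fun:
  assumes "holomorphic_on_H \<phi>"
  shows "torus_fun \<phi> m a b holomorphic_on {t. Im t > 0}"
proof -
  have "(\<lambda>t. \<phi> t (t *s cvec a + cvec b)) field_differentiable (at t)" if t: "Im t > 0" for t
  proof -
    obtain D where D: "((\<lambda>(t, w). \<phi> t w) has_derivative D) (at (t, t *s cvec a + cvec b))"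
      and Di: "\<And>u v. D (\<i> * u, \<i> *s v) = \<i> * D (u, v)"
      using assms t unfolding holomorphic_on_H_def by blast
    have lin: "bounded_linear D" using D by (rule has_derivative_bounded_linear)
    have bl: "bounded_linear (\<lambda>u. u *s cvec a)"
    proof (rule bounded_linear_intro)
      show "norm (u *s cvec a) \<le> norm u * norm (cvec a)" for u
        by (simp add: norm_vec_def L2_set_def norm_mult power_mult_distrib real_sqrt_mult
            flip: sum_distrib_left)
    qed (auto simp: vec_eq_iff algebra_simps)
    have g: "((\<lambda>t. (t, t *s cvec a + cvec b)) has_derivative (\<lambda>u. (u, u *s cvec a))) (at t)"
      by (auto intro!: derivative_eq_intros bounded_linear_imp_has_derivative bl)
    have "((\<lambda>t. \<phi> t (t *s cvec a + cvec b)) has_derivative (\<lambda>u. D (u, u *s cvec a))) (at t)"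
      using has_derivative_compose[OF g D] by simp
    moreover have "D (u, u *s cvec a) = D (1, cvec a) * u" for u
    proof -
      have "(u, u *s cvec a) = Re u *\<^sub>R (1, cvec a) + Im u *\<^sub>R (\<i> * 1, \<i> *s cvec a)"
        by (auto simp: vec_eq_iff complex_eq_iff)
      then have "D (u, u *s cvec a) = Re u *\<^sub>R D (1, cvec a) + Im u *\<^sub>R D (\<i> * 1, \<i> *s cvec a)"
        using lin by (simp only: linear_simps)
      also have "\<dots> = D (1, cvec a) * u"
        unfolding Di by (simp add: complex_eq_iff algebra_simps)
      finally show ?thesis .
    qed
    ultimately show ?thesis
      unfolding field_differentiable_def has_field_derivative_def by (intro exI[of _ "D (1, cvec a)"]) simp
  qed
  then have "(\<lambda>t. \<phi> t (t *s cvec a + cvec b)) holomorphic_on {t. Im t > 0}"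
    by (auto simp: holomorphic_on_def intro: field_differentiable_at_within)
  then show ?thesis
    unfolding torus_fun_def[abs_def] by (intro holomorphic_intros)
qed

text \<open>Used to carry a nonzero value of \<open>\<phi>\<close> over to nearby torsion
  points.\<close>

lemma holomorphic_on_H_continuous:
  assumes "holomorphic_on_H \<phi>" "Im t > 0"
  shows "isCont (\<phi> t) z"
proof -
  obtain D where D: "((\<lambda>(t, w). \<phi> t w) has_derivative D) (at (t, z))"
    using assms unfolding holomorphic_on_H_def by blast
  have "isCont (\<lambda>(t, w). \<phi> t w) (t, z)"
    using has_derivative_continuous[OF D] .
  moreover have "isCont (\<lambda>w. (t, w)) z" by (intro continuous_intros)
  ultimately have "isCont (\<lambda>w. (\<lambda>(t, w). \<phi> t w) (t, w)) z"
    using isCont_o2[of z "\<lambda>w. (t, w)" "\<lambda>(t, w). \<phi> t w"] by simp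
  then show ?thesis by simp
qed

section \<open>Growth at the cusp\<close>

text \<open>Once the lower coefficients are gone, dividing by \<open>q ^ n\<close> and letting
  \<open>q\<close> tend to 0 isolates \<open>a n\<close>. The point \<open>q = 0\<close> is excluded
  because \<open>exp (2 pi i t)\<close> is never 0.\<close>

lemma powser_zero_coeff:
  fixes a :: "nat \<Rightarrow> complex"
  assumes "\<And>q. q \<noteq> 0 \<Longrightarrow> cmod q < 1 \<Longrightarrow> (\<lambda>n. a n * q ^ n) sums 0"
  shows "a n = 0"
proof (induction n rule: less_induct)
  case (less n)
  have "(\<lambda>i. a (i + n) * q ^ i) sums 0" if q: "q \<noteq> 0" "cmod q < 1" for q
  proof -
    have "(\<Sum>i<n. a i * q ^ i) = 0" using less by simp
    then have "(\<lambda>i. a (i + n) * q ^ (i + n)) sums 0"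
      using sums_split_initial_segment[OF assms[OF q], of n] by simp
    then have "(\<lambda>i. a (i + n) * q ^ (i + n) / q ^ n) sums (0 / q ^ n)"
      by (rule sums_divide)
    then show ?thesis using q by (simp add: power_add)
  qed
  then have "((\<lambda>_. 0) \<longlongrightarrow> a (0 + n)) (at (0 :: complex))"
    by (intro powser_limit_0_strong[where s = 1 and a = "\<lambda>i. a (i + n)" and f = "\<lambda>_. 0"]) auto
  then show ?case
    using LIM_unique[OF tendsto_const] by force
qed

lemma ex_nome:
  assumes "q \<noteq> 0" "cmod q < 1"
  obtains t where "Im t > 0" "exp (2 * of_real pi * \<i> * t) = q"
proof
  show "exp (2 * of_real pi * \<i> * (Ln q / (2 * of_real pi * \<i>))) = q"
    using assms by simp
  show "Im (Ln q / (2 * of_real pi * \<i>)) > 0"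
    using assms by (simp add: Im_divide power2_eq_square field_simps)
qed

text \<open>For fixed \<open>z\<close>, summing over \<open>v\<close> first leaves a power series in
  \<open>q\<close> that vanishes on the punctured unit disc, so each of its coefficients is
  0.\<close>

lemma jacobi_expansion_vanishing:
  fixes L :: "(real ^ 'n) set"
  assumes exp: "jacobi_expansion L m \<phi> f" and van: "vanishes_on_H \<phi>"
  shows "((\<lambda>v. f n v * exp (2 * of_real pi * \<i> * cform (cvec v) z)) has_sum 0) (dual_lattice L)"
proof -
  let ?e = "\<lambda>v. exp (2 * of_real pi * \<i> * cform (cvec v) z)"
  have sum: "((\<lambda>(n, v). f n v * q ^ n * ?e v) has_sum 0) (UNIV \<times> dual_lattice L)"
    if q: "q \<noteq> 0" "cmod q < 1" for q
  proof -
    obtain t where t: "Im t > 0" "exp (2 * of_real pi * \<i> * t) = q"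
      using ex_nome[OF q] .
    have "((\<lambda>(n, v). f n v * exp (2 * of_real pi * \<i> * t) ^ n * ?e v) has_sum \<phi> t z)
        (UNIV \<times> dual_lattice L)"
      using exp t unfolding jacobi_expansion_def by blast
    then show ?thesis using van t by (simp add: vanishes_on_H_def)
  qed
  have summ: "(\<lambda>v. f n v * q ^ n * ?e v) summable_on dual_lattice L"
    if q: "q \<noteq> 0" "cmod q < 1" for q n
    using summable_on_SigmaD1[OF has_sum_imp_summable[OF sum[OF q]], of n] by simp
  \<comment> \<open>Summability is read off at \<open>q = 1/2\<close>, whose power is then removed
    by the factor \<open>2 ^ n\<close>.\<close>
  have sl: "(\<lambda>v. f n v * ?e v) summable_on dual_lattice L" for n
  proof -
    have "(\<lambda>v. f n v * (1/2) ^ n * ?e v * 2 ^ n) summable_on dual_lattice L"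
      by (rule summable_on_cmult_left[OF summ]) (auto simp: norm_divide)
    moreover have "f n v * (1/2) ^ n * ?e v * 2 ^ n = f n v * ?e v" for v
      by (simp add: power_divide)
    ultimately show ?thesis by simp
  qed
  define g where "g = (\<lambda>n. \<Sum>\<^sub>\<infinity>v\<in>dual_lattice L. f n v * ?e v)"
  have g: "((\<lambda>v. f n v * ?e v) has_sum g n) (dual_lattice L)" for n
    using sl by (simp add: g_def)
  have "g n = 0"
  proof (rule powser_zero_coeff)
    fix q :: complex assume q: "q \<noteq> 0" "cmod q < 1"
    have "((\<lambda>v. f n v * q ^ n * ?e v) has_sum (g n * q ^ n)) (dual_lattice L)" for n
      using has_sum_cmult_left[OF g[of n], of "q ^ n"] by (simp add: mult_ac)
    then have "((\<lambda>n. g n * q ^ n) has_sum 0) UNIV"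
      using has_sum_SigmaD[OF sum[OF q]] by simp
    then show "(\<lambda>n. g n * q ^ n) sums 0" by (rule has_sum_imp_sums)
  qed
  then show ?thesis using g[of n] by simp
qed

text \<open>The larger side is the exponent of \<open>q\<close> in the term \<open>(n, v)\<close>
  along a section with first component \<open>a\<close>. Cauchy-Schwarz bounds
  \<open>|v \<bullet> a|\<close> by the cross term of the square.\<close>

lemma cusp_exponent_ge_square:
  fixes v a :: "real ^ 'n"
  assumes v: "v \<bullet> v \<le> 2 * real n * real m"
  shows "(sqrt n - sqrt m * (norm a / sqrt 2))\<^sup>2 \<le> real n + v \<bullet> a + real m / 2 * (a \<bullet> a)"
proof -
  define r where "r = norm a / sqrt 2"
  have r2: "2 * r\<^sup>2 = a \<bullet> a" by (simp add: r_def power_divide power2_norm_eq_inner)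
  have "norm v \<le> sqrt (2 * (real n * real m))"
    using v by (simp add: norm_eq_sqrt_inner)
  then have "norm v * norm a \<le> sqrt (2 * (real n * real m)) * norm a"
    by (intro mult_right_mono) auto
  also have "\<dots> = 2 * (sqrt n * sqrt m * r)"
    by (simp add: r_def real_sqrt_mult field_simps)
  finally have "\<bar>v \<bullet> a\<bar> \<le> 2 * (sqrt n * sqrt m * r)"
    using Cauchy_Schwarz_ineq2[of v a] by linarith
  then have "(sqrt n - sqrt m * r)\<^sup>2 \<le> real n + v \<bullet> a + real m / 2 * (a \<bullet> a)"
    by (simp add: power2_eq_square algebra_simps flip: r2)
  then show ?thesis by (simp only: r_def)
qed

lemma cusp_exponent_nonneg:
  fixes v a :: "real ^ 'n"
  assumes "v \<bullet> v \<le> 2 * real n * real m"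
  shows "0 \<le> real n + v \<bullet> a + real m / 2 * (a \<bullet> a)"
  using cusp_exponent_ge_square[OF assms] by (meson order_trans zero_le_power2)

text \<open>\<open>x\<close> majorises \<open>norm a / sqrt 2\<close>, and \<open>m \<le> n\<close>
  comes from the symmetry of the series. Since \<open>x \<le> 1\<close>, the base
  \<open>sqrt m * (1 - x)\<close> is nonnegative and the comparison survives squaring.\<close>

lemma cusp_exponent_lower_bound:
  fixes v a :: "real ^ 'n"
  assumes v: "v \<bullet> v \<le> 2 * real n * real m" and n: "m \<le> n"
    and a: "a \<bullet> a \<le> 2 * x\<^sup>2" and x: "0 \<le> x" "x \<le> 1"
  shows "real m * (1 - x)\<^sup>2 \<le> real n + v \<bullet> a + real m / 2 * (a \<bullet> a)"
proof -
  define r where "r = norm a / sqrt 2"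
  have "r\<^sup>2 \<le> x\<^sup>2" using a by (simp add: r_def power_divide power2_norm_eq_inner)
  then have rx: "r \<le> x" using x(1) by (rule power2_le_imp_le)
  have "(sqrt m * (1 - x))\<^sup>2 \<le> (sqrt n - sqrt m * r)\<^sup>2"
  proof (rule power_mono)
    have "sqrt m * (1 - x) \<le> sqrt m * (1 - r)" using rx by (intro mult_left_mono) auto
    also have "\<dots> \<le> sqrt n - sqrt m * r" using n by (simp add: algebra_simps)
    finally show "sqrt m * (1 - x) \<le> sqrt n - sqrt m * r" .
  qed (use x in auto)
  also have "\<dots> \<le> real n + v \<bullet> a + real m / 2 * (a \<bullet> a)"
    unfolding r_def by (rule cusp_exponent_ge_square[OF v])
  finally show ?thesis by (simp add: power_mult_distrib)
qed

text \<open>The rows \<open>n < m\<close> sum to 0. From height \<open>1/2\<close> to height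
  \<open>Im t\<close> the modulus of any other term is multiplied by at most
  \<open>exp (- 2 pi w (Im t - 1/2))\<close>, so the absolutely convergent series at
  \<open>\<i> / 2\<close> is a majorant.\<close>

lemma torus_fun_growth:
  fixes L :: "(real ^ 'n) set"
  assumes exp: "jacobi_expansion L m \<phi> f"
    and low: "\<And>n z. n < m \<Longrightarrow>
      ((\<lambda>v. f n v * exp (2 * of_real pi * \<i> * cform (cvec v) z)) has_sum 0) (dual_lattice L)"
    and w: "\<And>n v. m \<le> n \<Longrightarrow> v \<in> dual_lattice L \<Longrightarrow> f n v \<noteq> 0 \<Longrightarrow>
      w \<le> real n + v \<bullet> a + real m / 2 * (a \<bullet> a)"
  shows "\<exists>C. \<forall>t. Im t \<ge> 1/2 \<longrightarrow> cmod (torus_fun \<phi> m a b t) \<le> C * exp (- (2 * pi * w * Im t))"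
proof -
  define I where "I = {m..} \<times> dual_lattice L"
  define z where "z = (\<lambda>t. t *s cvec a + cvec b)"
  define G where "G = (\<lambda>t (n, v). f n v * exp (2 * of_real pi * \<i> * t) ^ n
                       * exp (2 * of_real pi * \<i> * cform (cvec v) (z t)))"
  define c where "c = (\<lambda>t. exp (of_real pi * \<i> * of_nat m * (of_real (a \<bullet> a) * t)))"
  have sumG: "(G t has_sum \<phi> t (z t)) I" if t: "Im t > 0" for t
  proof -
    have full: "(G t has_sum \<phi> t (z t)) (UNIV \<times> dual_lattice L)"
      using exp t unfolding jacobi_expansion_def G_def by blast
    have "G t summable_on ({..<m} \<times> dual_lattice L)"
      by (rule summable_on_subset_banach[OF has_sum_imp_summable[OF full]]) auto
    then obtain s where s: "(G t has_sum s) ({..<m} \<times> dual_lattice L)"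
      by (auto simp: summable_on_def)
    have "((\<lambda>v. G t (n, v)) has_sum 0) (dual_lattice L)" if "n \<in> {..<m}" for n
      using has_sum_cmult_left[OF low[of n "z t"], of "exp (2 * of_real pi * \<i> * t) ^ n"] that
      by (simp add: G_def mult_ac)
    then have "((\<lambda>n. 0) has_sum s) {..<m}"
      using has_sum_SigmaD[OF s, of "\<lambda>_. 0"] by simp
    then have "s = 0" by (metis has_sum_0 has_sum_unique)
    then have "(G t has_sum (\<phi> t (z t) - 0)) (UNIV \<times> dual_lattice L - {..<m} \<times> dual_lattice L)"
      using s by (intro has_sum_Diff full) auto
    moreover have "UNIV \<times> dual_lattice L - {..<m} \<times> dual_lattice L = I"
      by (auto simp: I_def)
    ultimately show ?thesis by simp
  qed
  have cm: "cmod (c t * G t (n, v)) =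
      cmod (f n v) * exp (- (2 * pi * Im t * (real n + v \<bullet> a + real m / 2 * (a \<bullet> a))))" for t n v
    by (simp add: c_def G_def z_def norm_mult norm_power cform_simps exp_of_nat_mult[symmetric]
        mult_exp_exp algebra_simps)
  have sumc: "((\<lambda>i. c t * G t i) has_sum torus_fun \<phi> m a b t) I" if "Im t > 0" for t
    using has_sum_cmult_right[OF sumG[OF that], of "c t"]
    by (simp add: torus_fun_def c_def z_def)
  define u where "u = \<i> / 2"
  have u: "Im u = 1/2" by (simp add: u_def)
  have su: "(\<lambda>i. cmod (c u * G u i)) summable_on I"
    using has_sum_imp_summable[OF sumc[of u]] u by (simp flip: summable_on_iff_abs_summable_on_complex)
  show ?thesis
  proof (intro exI allI impI)
    fix t :: complex assume t: "Im t \<ge> 1/2"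
    have le: "cmod (c t * G t i) \<le> cmod (c u * G u i) * (exp (pi * w) * exp (- (2 * pi * w * Im t)))"
      if iI: "i \<in> I" for i
    proof -
      obtain n v where i: "i = (n, v)" "m \<le> n" "v \<in> dual_lattice L"
        using iI by (auto simp: I_def)
      show ?thesis
      proof (cases "f n v = 0")
        case False
        define E where "E = real n + v \<bullet> a + real m / 2 * (a \<bullet> a)"
        have "w \<le> E" using w[OF i(2,3) False] by (simp add: E_def)
        then have "w * (2 * pi * (Im t - 1/2)) \<le> E * (2 * pi * (Im t - 1/2))"
          using t by (intro mult_right_mono) auto
        then have "exp (- (2 * pi * Im t * E))
            \<le> exp (- (2 * pi * (1/2) * E)) * (exp (pi * w) * exp (- (2 * pi * w * Im t)))"
          by (simp add: mult_exp_exp algebra_simps)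
        then show ?thesis
          unfolding i(1) cm u by (fold E_def) (simp add: mult.assoc mult_left_mono)
      qed (simp add: i(1) G_def)
    qed
    have sr: "(\<lambda>i. cmod (c u * G u i) * (exp (pi * w) * exp (- (2 * pi * w * Im t)))) summable_on I"
      by (rule summable_on_cmult_left[OF su])
    have st: "(\<lambda>i. cmod (c t * G t i)) summable_on I"
      using has_sum_imp_summable[OF sumc[of t]] t by (simp flip: summable_on_iff_abs_summable_on_complex)
    have "cmod (torus_fun \<phi> m a b t) = cmod (\<Sum>\<^sub>\<infinity>i\<in>I. c t * G t i)"
      using sumc[of t] t by (simp add: infsumI)
    also have "\<dots> \<le> (\<Sum>\<^sub>\<infinity>i\<in>I. cmod (c t * G t i))"
      by (rule norm_infsum_bound[OF st])
    also have "\<dots> \<le> (\<Sum>\<^sub>\<infinity>i\<in>I. cmod (c u * G u i) * (exp (pi * w) * exp (- (2 * pi * w * Im t))))"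
      by (rule infsum_mono[OF st sr le])
    also have "\<dots> = (\<Sum>\<^sub>\<infinity>i\<in>I. cmod (c u * G u i)) * (exp (pi * w) * exp (- (2 * pi * w * Im t)))"
      by (rule infsum_cmult_left) (use su in blast)
    finally show "cmod (torus_fun \<phi> m a b t) \<le>
        ((\<Sum>\<^sub>\<infinity>i\<in>I. cmod (c u * G u i)) * exp (pi * w)) * exp (- (2 * pi * w * Im t))"
      by (simp add: mult.assoc)
  qed
qed

section \<open>Products over torsion points\<close>

text \<open>By the identity theorem no \<open>f i\<close> vanishes identically on the nonempty open
  set where the remaining functions are all nonzero.\<close>

lemma common_nonzero:
  fixes f :: "'i \<Rightarrow> complex \<Rightarrow> complex"
  assumes "finite I" and U: "open U" "connected U" and V: "open V" "V \<subseteq> U" "V \<noteq> {}"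
    and "\<And>i. i \<in> I \<Longrightarrow> f i holomorphic_on U" and "\<And>i. i \<in> I \<Longrightarrow> \<exists>z\<in>U. f i z \<noteq> 0"
  shows "\<exists>z\<in>V. \<forall>i\<in>I. f i z \<noteq> 0"
  using assms(1,7,8)
proof (induction I)
  case empty
  then show ?case using V by auto
next
  case (insert i I)
  define Q where "Q = (\<lambda>z. \<Prod>i\<in>I. f i z)"
  obtain z where z: "z \<in> V" "\<forall>i\<in>I. f i z \<noteq> 0" using insert by blast
  have Q: "Q holomorphic_on U"
    unfolding Q_def using insert.prems by (intro holomorphic_intros) auto
  then have contQ: "continuous_on V Q"
    using V(2) by (meson continuous_on_subset holomorphic_on_imp_continuous_on)
  define W where "W = V \<inter> Q -` (- {0})"
  have W: "open W" unfolding W_def using V(1) contQ by (intro continuous_open_preimage) auto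
  have "z \<in> W" using z insert.hyps by (simp add: W_def Q_def)
  show ?case
  proof (rule ccontr)
    assume no: "\<not> ?case"
    have "f i w = 0" if "w \<in> W" for w
    proof (rule ccontr)
      assume "f i w \<noteq> 0"
      moreover have "\<forall>i\<in>I. f i w \<noteq> 0" using that insert.hyps by (simp add: W_def Q_def)
      ultimately show False using no that by (auto simp: W_def)
    qed
    then have "f i w = 0" if "w \<in> U" for w
      using analytic_continuation_open[OF W U(1) _ U(2), of "f i" "\<lambda>_. 0" w] that \<open>z \<in> W\<close> V(2) insert.prems
      by (auto simp: W_def)
    then show False using insert.prems(2)[of i] by auto
  qed
qed

lemma bij_betw_PiE_pointwise:
  assumes "finite J" "\<And>j. j \<in> J \<Longrightarrow> finite (A j)"
    and g: "\<And>j. j \<in> J \<Longrightarrow> inj_on (g j) (A j)" "\<And>j x. j \<in> J \<Longrightarrow> x \<in> A j \<Longrightarrow> g j x \<in> A j"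
  shows "bij_betw (\<lambda>s. \<lambda>j\<in>J. g j (s j)) (PiE J A) (PiE J A)"
proof -
  have "inj_on (\<lambda>s. \<lambda>j\<in>J. g j (s j)) (PiE J A)"
  proof (rule inj_onI)
    fix s s' assume s: "s \<in> PiE J A" "s' \<in> PiE J A"
      and eq: "(\<lambda>j\<in>J. g j (s j)) = (\<lambda>j\<in>J. g j (s' j))"
    show "s = s'"
    proof (rule PiE_ext[OF s])
      fix j assume j: "j \<in> J"
      then have "g j (s j) = g j (s' j)" using fun_cong[OF eq, of j] by simp
      then show "s j = s' j" using g(1)[OF j] s j by (auto simp: inj_on_def PiE_iff)
    qed
  qed
  moreover have "finite (PiE J A)" using assms by (intro finite_PiE) auto
  moreover have "(\<lambda>s. \<lambda>j\<in>J. g j (s j)) ` PiE J A \<subseteq> PiE J A" using g(2) by (auto simp: PiE_iff)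
  ultimately show ?thesis by (simp add: bij_betw_def endo_inj_surj)
qed

text \<open>The solution is a natural number because it will count applications of a unipotent
  generator.\<close>

lemma chinese_remainder_int_family:
  fixes p :: "nat \<Rightarrow> nat" and u :: "nat \<Rightarrow> int"
  assumes "finite J" "\<And>j. j \<in> J \<Longrightarrow> prime (p j)" "inj_on p J"
  obtains n :: nat where "\<And>j. j \<in> J \<Longrightarrow> [int n = u j] (mod int (p j))"
proof -
  have "\<forall>i\<in>J. \<forall>j\<in>J. i \<noteq> j \<longrightarrow> coprime (p i) (p j)"
    using assms by (auto intro!: primes_coprime dest: inj_onD)
  then obtain n where n: "\<And>j. j \<in> J \<Longrightarrow> [n = nat (u j mod int (p j))] (mod p j)"
    using chinese_remainder_nat[OF assms(1), of p "\<lambda>j. nat (u j mod int (p j))"] by blast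
  have "[int n = u j] (mod int (p j))" if j: "j \<in> J" for j
  proof -
    have "p j > 0" using assms(2)[OF j] by (rule prime_gt_0_nat)
    then have "[int n = u j mod int (p j)] (mod int (p j))"
      using n[OF j] by (simp flip: cong_int_iff)
    then show ?thesis by (simp add: cong_def)
  qed
  then show ?thesis using that by blast
qed

lemma prime_cong_solve:
  fixes b c :: int and p :: nat
  assumes "prime p" "\<not> int p dvd b"
  obtains u where "[u * b = c] (mod int p)"
proof -
  have "coprime b (int p)"
    using assms by (metis coprime_commute prime_imp_coprime prime_int_nat_transfer prime_nat_int_transfer)
  then obtain x where "[b * x = 1] (mod int p)" using cong_solve_coprime_int by blast
  then have "[c * (b * x) = c * 1] (mod int p)" by (rule cong_scalar_left)
  then show ?thesis using that[of "c * x"] by (simp add: mult_ac)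
qed

lemma mod_add_inj:
  fixes a b c p :: int
  assumes "(b + a) mod p = (c + a) mod p" "0 \<le> b" "b < p" "0 \<le> c" "c < p"
  shows "b = c"
proof -
  have "[b + a = c + a] (mod p)" using assms by (simp add: cong_def)
  then have "[b = c] (mod p)" by (simp add: cong_add_rcancel)
  then show ?thesis using assms by (simp add: cong_def)
qed

lemma dvd_residue_zero:
  fixes a p :: int
  assumes "p dvd a" "0 \<le> a" "a < p"
  shows "a = 0"
  using assms zdvd_not_zless[of a p] by fastforce

text \<open>Convexity of the square; the two sides differ by \<open>(x - y)^2 / 2\<close>.\<close>

lemma two_squares_ge_mean:
  fixes x y r :: real
  assumes "x + y = r"
  shows "2 * (1 - r / 2)\<^sup>2 \<le> (1 - x)\<^sup>2 + (1 - y)\<^sup>2"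
proof -
  have "(1 - x)\<^sup>2 + (1 - y)\<^sup>2 - 2 * (1 - r / 2)\<^sup>2 = (x - y)\<^sup>2 / 2"
    unfolding assms[symmetric] by (simp add: power2_eq_square field_simps)
  moreover have "(x - y)\<^sup>2 / 2 \<ge> 0" by simp
  ultimately show ?thesis by linarith
qed

text \<open>Pairwise distinct prime denominators let the Chinese remainder theorem treat the
  coordinates independently.\<close>

locale torsion_points =
  fixes L :: "(real ^ 'n) set" and \<phi> :: "complex \<Rightarrow> complex ^ 'n \<Rightarrow> complex" and k :: int and m :: nat
    and e :: "nat \<Rightarrow> real ^ 'n" and p :: "nat \<Rightarrow> nat" and J :: "nat set"
  assumes holo: "holomorphic_on_H \<phi>"
    and modular: "jacobi_modular k m \<phi>"
    and elliptic: "jacobi_elliptic L m \<phi>"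
    and L_comb: "\<And>n :: nat \<Rightarrow> int. (\<Sum>j\<in>J. of_int (n j) *\<^sub>R e j) \<in> L"
    and finJ: "finite J"
    and prime_p: "\<And>j. j \<in> J \<Longrightarrow> prime (p j)"
    and inj_p: "inj_on p J"
begin

definition tvec :: "(nat \<Rightarrow> int) \<Rightarrow> real ^ 'n" where
  "tvec a = (\<Sum>j\<in>J. (of_int (a j) / real (p j)) *\<^sub>R e j)"

definition F :: "(nat \<Rightarrow> int) \<Rightarrow> (nat \<Rightarrow> int) \<Rightarrow> complex \<Rightarrow> complex" where
  "F a b = torus_fun \<phi> m (tvec a) (tvec b)"

definition nonvanishing :: "(nat \<Rightarrow> int) \<Rightarrow> (nat \<Rightarrow> int) \<Rightarrow> bool" where
  "nonvanishing a b \<longleftrightarrow> (\<exists>t. Im t > 0 \<and> F a b t \<noteq> 0)"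

text \<open>Modulo a prime the nonzero pairs form a single orbit of \<open>SL_2\<close>, whereas
  \<open>(0, 0)\<close> is fixed.\<close>

definition residue_pairs :: "nat \<Rightarrow> (int \<times> int) set" where
  "residue_pairs j = {0..<int (p j)} \<times> {0..<int (p j)} - {(0, 0)}"

definition S :: "(nat \<Rightarrow> int \<times> int) set" where
  "S = PiE J residue_pairs"

definition G :: "(nat \<Rightarrow> int \<times> int) \<Rightarrow> complex \<Rightarrow> complex" where
  "G s = F (\<lambda>j. fst (s j)) (\<lambda>j. snd (s j))"

section \<open>The action of \<open>SL_2\<close> over the integers on torsion points\<close>

lemma p_pos: "j \<in> J \<Longrightarrow> p j > 0"
  using prime_p prime_gt_0_nat by blast

lemma tvec_cong:
  assumes "\<And>j. j \<in> J \<Longrightarrow> [a j = a' j] (mod int (p j))"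
  shows "\<exists>x\<in>L. tvec a' = tvec a + x"
proof
  show "(\<Sum>j\<in>J. of_int ((a' j - a j) div int (p j)) *\<^sub>R e j) \<in> L" by (rule L_comb)
  have "of_int (a' j) / real (p j) = of_int (a j) / real (p j) + real_of_int ((a' j - a j) div int (p j))"
    if j: "j \<in> J" for j
  proof -
    have "int (p j) dvd a' j - a j"
      using assms[OF j] by (simp add: cong_iff_dvd_diff dvd_diff_commute)
    then obtain q where "a' j - a j = int (p j) * q" by blast
    moreover from this have "a' j = a j + int (p j) * q" by simp
    ultimately show ?thesis using p_pos[OF j] by (simp add: field_simps)
  qed
  then show "tvec a' = tvec a + (\<Sum>j\<in>J. of_int ((a' j - a j) div int (p j)) *\<^sub>R e j)"
    unfolding tvec_def sum.distrib[symmetric] by (intro sum.cong) (auto simp: scaleR_add_left)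
qed

lemma F_cong:
  assumes "\<And>j. j \<in> J \<Longrightarrow> [a j = a' j] (mod int (p j))" "\<And>j. j \<in> J \<Longrightarrow> [b j = b' j] (mod int (p j))"
    and "Im t > 0"
  shows "cmod (F a b t) = cmod (F a' b' t)"
proof -
  obtain x y where "x \<in> L" "y \<in> L" "tvec a' = tvec a + x" "tvec b' = tvec b + y"
    using tvec_cong[of a a'] tvec_cong[of b b'] assms by blast
  then show ?thesis
    using torus_fun_shift[OF elliptic, of x y t "tvec a" "tvec b"] assms by (simp add: F_def)
qed

lemma F_translate:
  assumes "Im t > 0"
  shows "cmod (F a b (t + 1)) = cmod (F a (\<lambda>j. b j + a j) t)"
proof -
  have "tvec (\<lambda>j. b j + a j) = tvec b + tvec a"
    by (simp add: tvec_def add_divide_distrib scaleR_add_left sum.distrib)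
  then show ?thesis using torus_fun_translate[OF modular assms] by (simp add: F_def)
qed

lemma F_invert:
  assumes "Im t > 0"
  shows "cmod (F a b (- 1 / t)) = cmod t powi k * cmod (F b (\<lambda>j. - a j) t)"
proof -
  have "tvec (\<lambda>j. - a j) = - tvec a"
    by (simp add: tvec_def sum_negf)
  then show ?thesis using torus_fun_invert[OF modular assms] by (simp add: F_def)
qed

lemma nonvanishing_cong:
  assumes "\<And>j. j \<in> J \<Longrightarrow> [a j = a' j] (mod int (p j))" "\<And>j. j \<in> J \<Longrightarrow> [b j = b' j] (mod int (p j))"
  shows "nonvanishing a b \<longleftrightarrow> nonvanishing a' b'"
  unfolding nonvanishing_def using F_cong[OF assms] by (metis norm_eq_zero)

lemma nonvanishing_translate: "nonvanishing a b \<longleftrightarrow> nonvanishing a (\<lambda>j. b j + a j)"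
proof
  assume "nonvanishing a b"
  then obtain t where t: "Im t > 0" "F a b t \<noteq> 0" by (auto simp: nonvanishing_def)
  then have "F a (\<lambda>j. b j + a j) (t - 1) \<noteq> 0"
    using F_translate[of "t - 1" a b] by auto
  then show "nonvanishing a (\<lambda>j. b j + a j)"
    unfolding nonvanishing_def using t by (intro exI[of _ "t - 1"]) auto
next
  assume "nonvanishing a (\<lambda>j. b j + a j)"
  then obtain t where t: "Im t > 0" "F a (\<lambda>j. b j + a j) t \<noteq> 0" by (auto simp: nonvanishing_def)
  then have "cmod (F a b (t + 1)) \<noteq> 0"
    using F_translate[of t a b] by simp
  then show "nonvanishing a b"
    unfolding nonvanishing_def using t by (intro exI[of _ "t + 1"]) auto
qed

lemma Im_neg_inverse: "Im t > 0 \<Longrightarrow> Im (- 1 / t) > 0"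
  by (auto simp: Im_divide intro!: divide_pos_pos add_nonneg_pos)

lemma nonvanishing_invert: "nonvanishing a b \<longleftrightarrow> nonvanishing b (\<lambda>j. - a j)"
proof
  assume "nonvanishing a b"
  then obtain t where t: "Im t > 0" "F a b t \<noteq> 0" by (auto simp: nonvanishing_def)
  have "- 1 / (- 1 / t) = t" by simp
  then have "F b (\<lambda>j. - a j) (- 1 / t) \<noteq> 0"
    using F_invert[OF Im_neg_inverse[OF t(1)], of a b] t by auto
  then show "nonvanishing b (\<lambda>j. - a j)"
    unfolding nonvanishing_def using Im_neg_inverse[OF t(1)] by blast
next
  assume "nonvanishing b (\<lambda>j. - a j)"
  then obtain t where t: "Im t > 0" "F b (\<lambda>j. - a j) t \<noteq> 0" by (auto simp: nonvanishing_def)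
  then have "t \<noteq> 0" by auto
  then have "F a b (- 1 / t) \<noteq> 0"
    using F_invert[OF t(1), of a b] t by auto
  then show "nonvanishing a b"
    unfolding nonvanishing_def using Im_neg_inverse[OF t(1)] by blast
qed

lemma nonvanishing_upper: "nonvanishing a b \<longleftrightarrow> nonvanishing a (\<lambda>j. b j + int n * a j)"
proof (induction n)
  case (Suc n)
  then show ?case
    using nonvanishing_translate[of a "\<lambda>j. b j + int n * a j"] by (simp add: algebra_simps)
qed simp

text \<open>The upper unipotent move conjugated by inversion: \<open>(a - n b, b)\<close> inverts to
  \<open>(b, -a + n b)\<close>, which is \<open>(b, -a)\<close> after \<open>n\<close>
  translations.\<close>

lemma nonvanishing_lower: "nonvanishing a b \<longleftrightarrow> nonvanishing (\<lambda>j. a j - int n * b j) b"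
  using nonvanishing_invert[of a b] nonvanishing_invert[of "\<lambda>j. a j - int n * b j" b]
    nonvanishing_upper[of b "\<lambda>j. - a j" n] by (simp add: algebra_simps)

text \<open>The two unipotent subgroups of \<open>SL\<^sub>2(\<int>)\<close>, used modulo all \<open>p j\<close> at once, move every
  nowhere zero family of residue pairs to the family that is constantly \<open>(1, 1)\<close>.\<close>

lemma nonvanishing_transitive:
  assumes "\<And>j. j \<in> J \<Longrightarrow> \<not> (int (p j) dvd a j \<and> int (p j) dvd b j)"
  shows "nonvanishing a b \<longleftrightarrow> nonvanishing (\<lambda>_. 1) (\<lambda>_. 1)"
proof -
  note crt = chinese_remainder_int_family[OF finJ prime_p inj_p]
  \<comment> \<open>Where \<open>p j\<close> divides \<open>b j\<close> it does not divide
    \<open>a j\<close>; adding \<open>a j\<close> exactly there makes every second entry a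
    unit.\<close>
  obtain n1 where n1: "\<And>j. j \<in> J \<Longrightarrow> [int n1 = (if int (p j) dvd b j then 1 else 0)] (mod int (p j))"
    using crt[of "\<lambda>j. if int (p j) dvd b j then 1 else 0"] by blast
  define b1 where "b1 = (\<lambda>j. b j + int n1 * a j)"
  have b1: "\<not> int (p j) dvd b1 j" if j: "j \<in> J" for j
  proof -
    have "[b1 j = b j + (if int (p j) dvd b j then 1 else 0) * a j] (mod int (p j))"
      unfolding b1_def by (intro cong_add cong_refl cong_mult n1 j)
    then show ?thesis using assms[OF j]
      by (auto simp: cong_dvd_iff dvd_add_right_iff split: if_splits)
  qed
  \<comment> \<open>Since \<open>b1 j\<close> is invertible, subtracting a multiple of it turns the
    first entry into 1.\<close>
  have "\<exists>u. [u * b1 j = a j - 1] (mod int (p j))" if "j \<in> J" for j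
    using prime_cong_solve[OF prime_p b1] that by metis
  then obtain u where u: "\<And>j. j \<in> J \<Longrightarrow> [u j * b1 j = a j - 1] (mod int (p j))"
    by metis
  obtain n2 where n2: "\<And>j. j \<in> J \<Longrightarrow> [int n2 = u j] (mod int (p j))"
    using crt[of u] by blast
  define a1 where "a1 = (\<lambda>j. a j - int n2 * b1 j)"
  have a1: "[a1 j = 1] (mod int (p j))" if j: "j \<in> J" for j
  proof -
    have "[int n2 * b1 j = a j - 1] (mod int (p j))"
      using cong_trans[OF cong_scalar_right[OF n2[OF j]] u[OF j]] .
    then have "[a j - int n2 * b1 j = a j - (a j - 1)] (mod int (p j))"
      by (intro cong_diff cong_refl)
    then show ?thesis by (simp add: a1_def)
  qed
  \<comment> \<open>The first entry now being 1, adding it \<open>1 - b1 j\<close> times turns the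
    second into 1 as well.\<close>
  obtain n3 where n3: "\<And>j. j \<in> J \<Longrightarrow> [int n3 = 1 - b1 j] (mod int (p j))"
    using crt[of "\<lambda>j. 1 - b1 j"] by blast
  have b2: "[b1 j + int n3 * a1 j = 1] (mod int (p j))" if j: "j \<in> J" for j
  proof -
    have "[b1 j + int n3 * a1 j = b1 j + (1 - b1 j) * 1] (mod int (p j))"
      by (intro cong_add cong_mult cong_refl n3 a1 j)
    then show ?thesis by simp
  qed
  have "nonvanishing a b \<longleftrightarrow> nonvanishing a b1"
    unfolding b1_def by (rule nonvanishing_upper)
  also have "\<dots> \<longleftrightarrow> nonvanishing a1 b1"
    unfolding a1_def by (rule nonvanishing_lower)
  also have "\<dots> \<longleftrightarrow> nonvanishing a1 (\<lambda>j. b1 j + int n3 * a1 j)"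
    by (rule nonvanishing_upper)
  also have "\<dots> \<longleftrightarrow> nonvanishing (\<lambda>_. 1) (\<lambda>_. 1)"
    using a1 b2 by (intro nonvanishing_cong) auto
  finally show ?thesis .
qed

section \<open>The product over all families of residue pairs\<close>

lemma finite_residue_pairs: "finite (residue_pairs j)"
  by (simp add: residue_pairs_def)

lemma finite_S: "finite S"
  unfolding S_def using finJ finite_residue_pairs by (intro finite_PiE) auto

lemma G_holomorphic: "G s holomorphic_on {t. Im t > 0}"
  unfolding G_def F_def by (rule holomorphic_torus_fun[OF holo])

text \<open>All of \<open>S\<close> lies in one orbit, so a single nonzero function forces every
  factor of the product to be nonzero somewhere.\<close>

lemma S_nonvanishing:
  assumes nz: "nonvanishing a b" "\<And>j. j \<in> J \<Longrightarrow> \<not> (int (p j) dvd a j \<and> int (p j) dvd b j)"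
    and s: "s \<in> S"
  shows "\<exists>t. Im t > 0 \<and> G s t \<noteq> 0"
proof -
  have "\<not> (int (p j) dvd fst (s j) \<and> int (p j) dvd snd (s j))" if j: "j \<in> J" for j
  proof -
    obtain x y where xy: "s j = (x, y)" by fastforce
    then have "(x, y) \<in> residue_pairs j" using s j by (auto simp: S_def PiE_iff)
    then have "0 \<le> x" "x < int (p j)" "0 \<le> y" "y < int (p j)" "x \<noteq> 0 \<or> y \<noteq> 0"
      by (auto simp: residue_pairs_def)
    then have "x > 0 \<and> x < int (p j) \<or> y > 0 \<and> y < int (p j)" by linarith
    then show ?thesis using zdvd_not_zless xy by auto
  qed
  then have "nonvanishing (\<lambda>j. fst (s j)) (\<lambda>j. snd (s j))"
    using nonvanishing_transitive[of a b] nonvanishing_transitive[of "\<lambda>j. fst (s j)" "\<lambda>j. snd (s j)"]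
      nz by blast
  then show ?thesis by (simp add: nonvanishing_def G_def)
qed

text \<open>Injective self-maps of the finite sets of residue pairs permute \<open>S\<close>; up to
  modulus and weight, translation and inversion act in this way.\<close>

lemma prod_G_reindex:
  fixes g :: "nat \<Rightarrow> int \<times> int \<Rightarrow> int \<times> int"
  assumes g: "\<And>j. j \<in> J \<Longrightarrow> inj_on (g j) (residue_pairs j)"
      "\<And>j x. j \<in> J \<Longrightarrow> x \<in> residue_pairs j \<Longrightarrow> g j x \<in> residue_pairs j"
    and eq: "\<And>s. s \<in> S \<Longrightarrow> h s = cmod (G (\<lambda>j\<in>J. g j (s j)) t)"
  shows "(\<Prod>s\<in>S. h s) = (\<Prod>s\<in>S. cmod (G s t))"
proof -
  have "(\<Prod>s\<in>S. cmod (G (\<lambda>j\<in>J. g j (s j)) t)) = (\<Prod>s\<in>S. cmod (G s t))"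
    unfolding S_def
    by (rule prod.reindex_bij_betw[OF bij_betw_PiE_pointwise[OF finJ finite_residue_pairs g]])
  then show ?thesis using eq by simp
qed

lemma prod_G_translate:
  assumes t: "Im t > 0"
  shows "(\<Prod>s\<in>S. cmod (G s (t + 1))) = (\<Prod>s\<in>S. cmod (G s t))"
proof (rule prod_G_reindex[where g = "\<lambda>j (a, b). (a, (b + a) mod int (p j))"])
  fix j assume j: "j \<in> J"
  show "inj_on (\<lambda>(a, b). (a, (b + a) mod int (p j))) (residue_pairs j)"
    by (auto simp: inj_on_def residue_pairs_def dest: mod_add_inj)
  show "(case x of (a, b) \<Rightarrow> (a, (b + a) mod int (p j))) \<in> residue_pairs j"
    if "x \<in> residue_pairs j" for x
    using that p_pos[OF j] by (auto simp: residue_pairs_def) (metis dvd_residue_zero)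
next
  fix s assume "s \<in> S"
  show "cmod (G s (t + 1)) = cmod (G (\<lambda>j\<in>J. case s j of (a, b) \<Rightarrow> (a, (b + a) mod int (p j))) t)"
    unfolding G_def F_translate[OF t]
    by (rule F_cong[OF _ _ t]) (auto simp: cong_def split: prod.splits)
qed

lemma prod_G_invert:
  assumes t: "Im t > 0"
  shows "(\<Prod>s\<in>S. cmod (G s (- 1 / t))) = (cmod t powi k) ^ card S * (\<Prod>s\<in>S. cmod (G s t))"
proof -
  have "(\<Prod>s\<in>S. cmod (F (\<lambda>j. snd (s j)) (\<lambda>j. - fst (s j)) t)) = (\<Prod>s\<in>S. cmod (G s t))"
  proof (rule prod_G_reindex[where g = "\<lambda>j (a, b). (b, (- a) mod int (p j))"])
    fix j assume j: "j \<in> J"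
    have minus_inj: "x = y" if "(- x) mod int (p j) = (- y) mod int (p j)" "0 \<le> x" "x < int (p j)" "0 \<le> y" "y < int (p j)"
      for x y
    proof -
      have "[x = y] (mod int (p j))" using that(1) cong_minus_minus_iff[of x y "int (p j)"] by (simp add: cong_def)
      then show ?thesis using that by (simp add: cong_def)
    qed
    show "inj_on (\<lambda>(a, b). (b, (- a) mod int (p j))) (residue_pairs j)"
      by (auto simp: inj_on_def residue_pairs_def dest: minus_inj)
    show "(case x of (a, b) \<Rightarrow> (b, (- a) mod int (p j))) \<in> residue_pairs j"
      if "x \<in> residue_pairs j" for x
      using that p_pos[OF j] by (auto simp: residue_pairs_def) (metis dvd_residue_zero)
  next
    fix s assume "s \<in> S"
    show "cmod (F (\<lambda>j. snd (s j)) (\<lambda>j. - fst (s j)) t) =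
        cmod (G (\<lambda>j\<in>J. case s j of (a, b) \<Rightarrow> (b, (- a) mod int (p j))) t)"
      unfolding G_def
      by (rule F_cong[OF _ _ t]) (auto simp: cong_def split: prod.splits)
  qed
  then show ?thesis
    unfolding G_def F_invert[OF t] by (simp add: prod.distrib)
qed

text \<open>The product of all \<open>G s\<close> transforms in modulus with weight
  \<open>k * card S\<close> and has order at least the sum of the \<open>w s\<close> at the cusp.
  \<open>common_nonzero\<close> shows that it does not vanish identically.\<close>

lemma weight_ge_total_order:
  assumes nz: "nonvanishing a b" "\<And>j. j \<in> J \<Longrightarrow> \<not> (int (p j) dvd a j \<and> int (p j) dvd b j)"
    and k: "k \<ge> 0"
    and growth: "\<And>s. s \<in> S \<Longrightarrow> \<exists>C. \<forall>t. Im t \<ge> 1/2 \<longrightarrow> cmod (G s t) \<le> C * exp (- (2 * pi * w s * Im t))"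
  shows "2 * sqrt 3 * pi * (\<Sum>s\<in>S. w s) \<le> of_int k * real (card S)"
proof -
  define P where "P = (\<lambda>t. \<Prod>s\<in>S. G s t)"
  have nP: "cmod (P t) = (\<Prod>s\<in>S. cmod (G s t))" for t
    by (simp add: P_def prod_norm)
  have "\<exists>t\<in>{t. Im t > 1}. \<forall>s\<in>S. G s t \<noteq> 0"
  proof (rule common_nonzero[where U = "{t. Im t > 0}"])
    show "{t. Im t > 1} \<noteq> {}" by (auto intro!: exI[of _ "2 * \<i>"])
    show "\<exists>z\<in>{t. Im t > 0}. G s z \<noteq> 0" if "s \<in> S" for s
      using S_nonvanishing[OF nz that] by blast
  qed (use finite_S G_holomorphic in
      \<open>auto simp: open_halfspace_Im_gt convex_connected convex_halfspace_Im_gt\<close>)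
  then obtain t1 where t1: "Im t1 > 1" "\<forall>s\<in>S. G s t1 \<noteq> 0" by blast
  obtain C where C: "\<And>s t. s \<in> S \<Longrightarrow> Im t \<ge> 1/2 \<Longrightarrow> cmod (G s t) \<le> C s * exp (- (2 * pi * w s * Im t))"
    using growth by metis
  show ?thesis
  proof (rule modular_order_bound[of P])
    show "P holomorphic_on {t. 0 < Im t}"
      unfolding P_def by (intro holomorphic_intros G_holomorphic)
    show "cmod (P (t + 1)) = cmod (P t)" if "Im t > 0" for t
      unfolding nP using prod_G_translate[OF that] .
    show "cmod (P (- 1 / t)) = cmod t powr (of_int k * real (card S)) * cmod (P t)" if t: "Im t > 0" for t
    proof -
      have "t \<noteq> 0" using t by auto
      then have "(cmod t powi k) ^ card S = cmod t powr (of_int k * real (card S))"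
        by (simp add: powr_powr flip: powr_real_of_int' powr_realpow)
      then show ?thesis unfolding nP prod_G_invert[OF t] by simp
    qed
    show "cmod (P t) \<le> (\<Prod>s\<in>S. C s) * exp (- (2 * pi * (\<Sum>s\<in>S. w s) * Im t))" if t: "1/2 \<le> Im t" for t
    proof -
      have "cmod (P t) \<le> (\<Prod>s\<in>S. C s * exp (- (2 * pi * w s * Im t)))"
        unfolding nP by (intro prod_mono) (use C t in auto)
      also have "\<dots> = (\<Prod>s\<in>S. C s) * exp (\<Sum>s\<in>S. - (2 * pi * w s * Im t))"
        by (simp add: prod.distrib exp_sum finite_S)
      also have "(\<Sum>s\<in>S. - (2 * pi * w s * Im t)) = - (2 * pi * (\<Sum>s\<in>S. w s) * Im t)"
        by (simp add: sum_negf sum_distrib_left sum_distrib_right)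
      finally show ?thesis .
    qed
    show "1 \<le> Im t1" "P t1 \<noteq> 0" using t1 finite_S by (auto simp: P_def)
    show "0 \<le> of_int k * real (card S)" using k by simp
  qed
qed

text \<open>Points whose first components lie in a box around 0 contribute
  \<open>m (1 - x)^2\<close> to the order, all others at least 0. In each coordinate the box holds
  \<open>2 A j * p j\<close> of fewer than \<open>p j ^ 2\<close> pairs, which produces the factor
  \<open>2 A j / p j\<close>.\<close>

lemma box_weight_bound:
  fixes A :: "nat \<Rightarrow> int" and d :: "nat \<Rightarrow> nat"
  assumes k: "k \<ge> 0"
    and nz: "nonvanishing a0 b0" "\<And>j. j \<in> J \<Longrightarrow> \<not> (int (p j) dvd a0 j \<and> int (p j) dvd b0 j)"
    and exp: "jacobi_expansion L m \<phi> f"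
    and low: "\<And>n z. n < m \<Longrightarrow>
      ((\<lambda>v. f n v * exp (2 * of_real pi * \<i> * cform (cvec v) z)) has_sum 0) (dual_lattice L)"
    and orth: "\<And>i j. i \<in> J \<Longrightarrow> j \<in> J \<Longrightarrow> e i \<bullet> e j = (if i = j then 2 * real (d j) else 0)"
    and A: "\<And>j. j \<in> J \<Longrightarrow> A j \<ge> 0" "\<And>j. j \<in> J \<Longrightarrow> 2 * A j < int (p j)"
    and r_def: "r = (\<Sum>j\<in>J. sqrt (d j) * (of_int (A j + 1) / real (p j)))" and r1: "r \<le> 1"
  shows "2 * sqrt 3 * pi * (real m * (1 - r / 2)\<^sup>2) * (\<Prod>j\<in>J. 2 * of_int (A j) / real (p j)) \<le> of_int k"
proof -
  \<comment> \<open>The centred representative: residues just below \<open>p j\<close> count as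
    small negative numbers.\<close>
  define cen where "cen = (\<lambda>j a. if a \<le> A j then a else a - int (p j))"
  \<comment> \<open>As \<open>e j\<close> has norm \<open>sqrt (2 d j)\<close>, the summands are the
    coordinate lengths divided by \<open>sqrt 2\<close>. Their sum dominates the Euclidean length
    and, unlike it, is linear in \<open>|cen|\<close>, so that reflection acts on it
    exactly.\<close>
  define x where "x = (\<lambda>s :: nat \<Rightarrow> int \<times> int. \<Sum>j\<in>J. sqrt (d j) * (\<bar>of_int (cen j (fst (s j)))\<bar> / real (p j)))"
  \<comment> \<open>Residue 0 is left out: all pairs in the box are then nonzero, and
    \<open>|cen|\<close> takes each value in \<open>1..A j\<close> twice.\<close>
  define A2 where "A2 = (\<lambda>j. {1..A j} \<union> {int (p j) - A j..int (p j) - 1})"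
  define Bj where "Bj = (\<lambda>j. A2 j \<times> {0..<int (p j)})"
  define B where "B = PiE J Bj"
  \<comment> \<open>\<open>\<rho>\<close> reflects the box, turning \<open>x s\<close> into \<open>r - x s\<close>, so that the average of \<open>(1 - x s)\<^sup>2\<close> over the
    box is at least \<open>(1 - r/2)\<^sup>2\<close> by convexity.\<close>
  define \<rho> where "\<rho> = (\<lambda>j (a, b :: int). (if a \<le> A j then A j + 1 - a else 2 * int (p j) - A j - 1 - a, b))"
  define w where "w = (\<lambda>s. if s \<in> B then real m * (1 - x s)\<^sup>2 else 0)"
  have cen_le: "\<bar>cen j a\<bar> \<le> A j" if "j \<in> J" "a \<in> A2 j" for j a
    using that A[OF that(1)] by (auto simp: cen_def A2_def)
  \<comment> \<open>Reversing \<open>1..A j\<close> sends \<open>c\<close> to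
    \<open>A j + 1 - c\<close>; this is the origin of \<open>A j + 1\<close> in
    \<open>r\<close>.\<close>
  have cen_refl: "\<bar>cen j (fst (\<rho> j ab))\<bar> = A j + 1 - \<bar>cen j (fst ab)\<bar>" "\<rho> j ab \<in> Bj j"
    if "j \<in> J" "ab \<in> Bj j" for j ab
    using that A[OF that(1)] by (auto simp: cen_def A2_def Bj_def \<rho>_def split: prod.splits)
  have rho_inj: "inj_on (\<rho> j) (Bj j)" if "j \<in> J" for j
    using A[OF that] by (auto simp: inj_on_def Bj_def A2_def \<rho>_def split: if_splits)
  have finBj: "finite (Bj j)" for j by (simp add: Bj_def A2_def)
  have finB: "finite B" unfolding B_def by (intro finite_PiE finJ finBj)
  have BS: "B \<subseteq> S"
    unfolding B_def S_def
  proof (rule PiE_mono)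
    fix j assume "j \<in> J"
    then show "Bj j \<subseteq> residue_pairs j"
      using A[of j] by (auto simp: Bj_def A2_def residue_pairs_def)
  qed
  have in_A2: "fst (s j) \<in> A2 j" "s j \<in> Bj j" if "s \<in> B" "j \<in> J" for s j
    using that by (auto simp: B_def Bj_def PiE_iff mem_Times_iff)
  have x0: "0 \<le> x s" for s
    unfolding x_def by (intro sum_nonneg mult_nonneg_nonneg divide_nonneg_nonneg) auto
  have xr: "x s \<le> r" if "s \<in> B" for s
    unfolding x_def r_def
  proof (intro sum_mono mult_left_mono divide_right_mono)
    fix j assume j: "j \<in> J"
    have "\<bar>cen j (fst (s j))\<bar> \<le> A j + 1"
      using cen_le[OF j in_A2(1)[OF that j]] by simp
    then show "\<bar>real_of_int (cen j (fst (s j)))\<bar> \<le> of_int (A j + 1)"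
      by (metis of_int_abs of_int_le_iff)
  qed auto
  have xrefl: "x s + x (\<lambda>j\<in>J. \<rho> j (s j)) = r" if "s \<in> B" for s
    unfolding x_def r_def sum.distrib[symmetric]
  proof (rule sum.cong[OF refl])
    fix j assume j: "j \<in> J"
    define u where "u = \<bar>real_of_int (cen j (fst (s j)))\<bar>"
    define v where "v = \<bar>real_of_int (cen j (fst ((\<lambda>j\<in>J. \<rho> j (s j)) j)))\<bar>"
    have "\<bar>cen j (fst (s j))\<bar> + \<bar>cen j (fst (\<rho> j (s j)))\<bar> = A j + 1"
      using cen_refl(1)[OF j in_A2(2)[OF that j]] by simp
    then have "u + v = of_int (A j + 1)"
      unfolding u_def v_def using j by (simp del: of_int_add flip: of_int_abs of_int_add)
    moreover have "sqrt (d j) * (u / real (p j)) + sqrt (d j) * (v / real (p j))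
        = sqrt (d j) * ((u + v) / real (p j))"
      by (simp add: add_divide_distrib distrib_left)
    ultimately show "sqrt (d j) * (\<bar>real_of_int (cen j (fst (s j)))\<bar> / real (p j))
        + sqrt (d j) * (\<bar>real_of_int (cen j (fst ((\<lambda>j\<in>J. \<rho> j (s j)) j)))\<bar> / real (p j))
        = sqrt (d j) * (of_int (A j + 1) / real (p j))"
      unfolding u_def v_def by simp
  qed
  have sumw: "(\<Sum>s\<in>S. w s) \<ge> real m * (real (card B) * (1 - r / 2)\<^sup>2)"
  proof -
    have bij: "bij_betw (\<lambda>s. \<lambda>j\<in>J. \<rho> j (s j)) B B"
      unfolding B_def by (intro bij_betw_PiE_pointwise finJ finBj rho_inj cen_refl(2))
    have "2 * (\<Sum>s\<in>B. (1 - x s)\<^sup>2)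
        = (\<Sum>s\<in>B. (1 - x s)\<^sup>2) + (\<Sum>s\<in>B. (1 - x (\<lambda>j\<in>J. \<rho> j (s j)))\<^sup>2)"
      using sum.reindex_bij_betw[OF bij, of "\<lambda>s. (1 - x s)\<^sup>2"] by simp
    also have "\<dots> \<ge> (\<Sum>s\<in>B. 2 * (1 - r / 2)\<^sup>2)"
      unfolding sum.distrib[symmetric] by (intro sum_mono two_squares_ge_mean xrefl)
    finally have "(\<Sum>s\<in>B. (1 - x s)\<^sup>2) \<ge> real (card B) * (1 - r / 2)\<^sup>2" by simp
    then have "real m * (\<Sum>s\<in>B. (1 - x s)\<^sup>2) \<ge> real m * (real (card B) * (1 - r / 2)\<^sup>2)"
      by (intro mult_left_mono) auto
    moreover have "(\<Sum>s\<in>S. w s) = real m * (\<Sum>s\<in>B. (1 - x s)\<^sup>2)"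
      unfolding sum_distrib_left using BS finite_S
      by (intro sum.mono_neutral_cong_right) (auto simp: w_def)
    ultimately show ?thesis by simp
  qed
  have growth: "\<exists>C. \<forall>t. Im t \<ge> 1/2 \<longrightarrow> cmod (G s t) \<le> C * exp (- (2 * pi * w s * Im t))" for s
  proof -
    have bound: "v \<bullet> v \<le> 2 * real n * real m" if "v \<in> dual_lattice L" "f n v \<noteq> 0" for n v
      using exp that unfolding jacobi_expansion_def by blast
    show ?thesis
    proof (cases "s \<in> B")
      case False
      have "\<exists>C. \<forall>t. Im t \<ge> 1/2 \<longrightarrow> cmod (G s t) \<le> C * exp (- (2 * pi * 0 * Im t))"
        unfolding G_def F_def
        by (rule torus_fun_growth[OF exp low]) (assumption, rule cusp_exponent_nonneg, rule bound)
      then show ?thesis using False by (simp add: w_def)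
    next
      case True
      define a where "a = (\<lambda>j. cen j (fst (s j)))"
      have "tvec a \<bullet> tvec a = (\<Sum>j\<in>J. (of_int (a j) / real (p j))\<^sup>2 * (2 * real (d j)))"
        unfolding tvec_def inner_sum_left inner_sum_right
        by (intro sum.cong refl) (simp add: orth finJ if_distrib power2_eq_square cong: if_cong)
      also have "\<dots> = 2 * (\<Sum>j\<in>J. (sqrt (d j) * (\<bar>of_int (a j)\<bar> / real (p j)))\<^sup>2)"
        by (simp add: sum_distrib_left power_mult_distrib power_divide mult_ac)
      also have "\<dots> \<le> 2 * (x s)\<^sup>2"
      proof -
        have "L2_set (\<lambda>j. sqrt (d j) * (\<bar>of_int (a j)\<bar> / real (p j))) J \<le> x s"
          unfolding x_def a_def by (intro L2_set_le_sum) auto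
        then have "(L2_set (\<lambda>j. sqrt (d j) * (\<bar>of_int (a j)\<bar> / real (p j))) J)\<^sup>2 \<le> (x s)\<^sup>2"
          by (intro power_mono) auto
        then show ?thesis by (simp add: L2_set_def sum_nonneg)
      qed
      finally have norm_a: "tvec a \<bullet> tvec a \<le> 2 * (x s)\<^sup>2" .
      have x1: "x s \<le> 1" using xr[OF True] r1 by simp
      have "\<exists>C. \<forall>t. Im t \<ge> 1/2 \<longrightarrow>
          cmod (F a (\<lambda>j. snd (s j)) t) \<le> C * exp (- (2 * pi * (real m * (1 - x s)\<^sup>2) * Im t))"
        unfolding F_def
        by (rule torus_fun_growth[OF exp low])
          (assumption, rule cusp_exponent_lower_bound[OF bound _ norm_a x0 x1])
      \<comment> \<open>Centring changes residues by multiples of \<open>p j\<close>, that is, the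
        point by a lattice vector.\<close>
      moreover have "cmod (G s t) = cmod (F a (\<lambda>j. snd (s j)) t)" if "Im t > 0" for t
        unfolding G_def by (rule F_cong[OF _ _ that]) (auto simp: a_def cen_def cong_def)
      ultimately show ?thesis using True by (simp add: w_def)
    qed
  qed
  have cardB: "real (card B) = (\<Prod>j\<in>J. 2 * of_int (A j) * real (p j))"
  proof -
    have "real (card (Bj j)) = 2 * of_int (A j) * real (p j)" if "j \<in> J" for j
    proof -
      have "card (A2 j) = card {1..A j} + card {int (p j) - A j..int (p j) - 1}"
        unfolding A2_def using A[OF that] by (intro card_Un_disjoint) auto
      then have "real (card (A2 j)) = 2 * of_int (A j)" using A[OF that] by simp
      then show ?thesis by (simp add: Bj_def card_cartesian_product)
    qed
    then show ?thesis by (simp add: B_def card_PiE finJ)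
  qed
  \<comment> \<open>Counting \<open>(0, 0)\<close> as well keeps an upper bound and gives powers of
    \<open>p j\<close> that cancel against \<open>card B\<close>.\<close>
  have cardS: "real (card S) \<le> (\<Prod>j\<in>J. real (p j) * real (p j))"
  proof -
    have "card (residue_pairs j) \<le> p j * p j" for j
      using card_mono[of "{0..<int (p j)} \<times> {0..<int (p j)}" "residue_pairs j"]
      by (simp add: residue_pairs_def card_cartesian_product)
    then have "card S \<le> (\<Prod>j\<in>J. p j * p j)"
      unfolding S_def card_PiE[OF finJ] by (intro prod_mono) auto
    then have "real (card S) \<le> real (\<Prod>j\<in>J. p j * p j)" by (simp only: of_nat_le_iff)
    then show ?thesis by simp
  qed
  define c where "c = 2 * sqrt 3 * pi * (real m * (1 - r / 2)\<^sup>2)"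
  have "c * real (card B) = 2 * sqrt 3 * pi * (real m * (real (card B) * (1 - r / 2)\<^sup>2))"
    by (simp add: c_def)
  also have "\<dots> \<le> 2 * sqrt 3 * pi * (\<Sum>s\<in>S. w s)"
    using sumw by (intro mult_left_mono) auto
  also have "\<dots> \<le> of_int k * real (card S)"
    by (rule weight_ge_total_order[OF nz k growth])
  also have "\<dots> \<le> of_int k * (\<Prod>j\<in>J. real (p j) * real (p j))"
    using cardS k by (intro mult_left_mono) auto
  finally have main: "c * (\<Prod>j\<in>J. 2 * of_int (A j) * real (p j)) \<le> of_int k * (\<Prod>j\<in>J. real (p j) * real (p j))"
    unfolding cardB .
  have "(\<Prod>j\<in>J. 2 * of_int (A j) / real (p j)) * (\<Prod>j\<in>J. real (p j) * real (p j))
      = (\<Prod>j\<in>J. 2 * of_int (A j) * real (p j))"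
    unfolding prod.distrib[symmetric] by (intro prod.cong refl) (use p_pos in \<open>auto simp: field_simps\<close>)
  then have "c * (\<Prod>j\<in>J. 2 * of_int (A j) / real (p j)) * (\<Prod>j\<in>J. real (p j) * real (p j))
      \<le> of_int k * (\<Prod>j\<in>J. real (p j) * real (p j))"
    using main by (simp add: mult.assoc)
  moreover have "(\<Prod>j\<in>J. real (p j) * real (p j)) > 0"
    using p_pos by (intro prod_pos) auto
  ultimately show ?thesis unfolding c_def by (rule mult_right_le_imp_le)
qed

end

section \<open>The slope bound\<close>

text \<open>Applied to integer roundings \<open>u n\<close> of \<open>P n * x\<close>.\<close>

lemma tendsto_ratio:
  fixes P :: "nat \<Rightarrow> real"
  assumes P: "filterlim P at_top sequentially" and u: "\<And>n. \<bar>u n - P n * x\<bar> \<le> c"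
  shows "(\<lambda>n. u n / P n) \<longlonglongrightarrow> x"
proof -
  have lim: "(\<lambda>n. c / P n) \<longlonglongrightarrow> 0"
    by (rule tendsto_divide_0[OF tendsto_const filterlim_at_top_imp_at_infinity[OF P]])
  have "eventually (\<lambda>n. norm (u n / P n - x) \<le> c / P n) sequentially"
    using filterlim_at_top_dense[THEN iffD1, OF P, rule_format, of 0]
  proof eventually_elim
    case (elim n)
    then have "u n / P n - x = (u n - P n * x) / P n" by (simp add: field_simps)
    then show ?case using u[of n] elim by (simp add: divide_right_mono)
  qed
  then have "(\<lambda>n. u n / P n - x) \<longlonglongrightarrow> 0"
    using lim by (rule Lim_null_comparison)
  then show ?thesis by (simp add: LIM_zero_iff)
qed

text \<open>Torsion points with large prime denominators approximate \<open>z0\<close>, so by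
  continuity \<open>\<phi>\<close> is nonzero at them. \<open>box_weight_bound\<close>, for boxes
  whose relative half-widths tend to \<open>s / sqrt (d j)\<close>, then passes to the
  limit.\<close>

lemma fourier_jacobi_weight_bound:
  fixes L :: "(real ^ 'n) set" and \<phi> :: "complex \<Rightarrow> complex ^ 'n \<Rightarrow> complex" and e :: "nat \<Rightarrow> real ^ 'n"
    and d :: "nat \<Rightarrow> nat"
  assumes holo: "holomorphic_on_H \<phi>" and modular: "jacobi_modular k m \<phi>"
    and elliptic: "jacobi_elliptic L m \<phi>" and exp: "jacobi_expansion L m \<phi> f"
    and low: "\<And>n z. n < m \<Longrightarrow>
      ((\<lambda>v. f n v * exp (2 * of_real pi * \<i> * cform (cvec v) z)) has_sum 0) (dual_lattice L)"
    and nz: "Im t0 > 0" "\<phi> t0 z0 \<noteq> 0"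
    and k: "k \<ge> 0" and l: "l \<ge> 1"
    and L_comb: "\<And>n :: nat \<Rightarrow> int. (\<Sum>j=1..l. of_int (n j) *\<^sub>R e j) \<in> L"
    and span: "\<And>x. \<exists>c. x = (\<Sum>j=1..l. c j *\<^sub>R e j)"
    and orth: "\<And>i j. i \<in> {1..l} \<Longrightarrow> j \<in> {1..l} \<Longrightarrow> e i \<bullet> e j = (if i = j then 2 * real (d j) else 0)"
    and d: "\<And>j. j \<in> {1..l} \<Longrightarrow> d j > 0"
    and s: "s > 0" "s * real l \<le> 1" "s \<le> 1/2"
  shows "2 * sqrt 3 * pi * (real m * (1 - s * real l / 2)\<^sup>2) * (\<Prod>j=1..l. 2 * (s / sqrt (d j))) \<le> of_int k"
proof -
  define J where "J = {1..l}"
  \<comment> \<open>For fixed \<open>n\<close> these primes are distinct in \<open>j\<close>; the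
    index being at least \<open>n\<close>, they tend to infinity with \<open>n\<close>.\<close>
  define p where "p = (\<lambda>n j. enumerate {q :: nat. prime q} (n * (l + 1) + j))"
  note inf = primes_infinite
  have prime_p: "prime (p n j)" for n j
    using enumerate_in_set[OF inf] by (simp add: p_def)
  have p_ge: "n \<le> p n j" for n j
  proof -
    have "n \<le> n * (l + 1) + j" by simp
    also have "\<dots> \<le> p n j" unfolding p_def by (rule le_enumerate[OF inf])
    finally show ?thesis .
  qed
  have inj_p: "inj_on (p n) J" for n
    using strict_mono_enumerate[OF inf] by (auto simp: inj_on_def p_def strict_mono_eq)
  have p_top: "filterlim (\<lambda>n. real (p n j)) at_top sequentially" for j
    by (rule filterlim_at_top_mono[OF filterlim_real_sequentially]) (simp add: p_ge)
  have p0: "real (p n j) > 0" for n j using prime_gt_0_nat[OF prime_p] by simp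
  have tp: "torsion_points L \<phi> k m e (p n) J" for n
    using holo modular elliptic L_comb prime_p inj_p by unfold_locales (auto simp: J_def)

  \<comment> \<open>Real coordinates of \<open>z0\<close> on the section through it at
    \<open>t0\<close>: \<open>z0 = t0 xl + yl\<close>.\<close>
  define xl where "xl = (\<chi> i. Im (z0 $ i) / Im t0)"
  define yl where "yl = (\<chi> i. Re (z0 $ i) - Re t0 * (xl $ i))"
  obtain x where x: "xl = (\<Sum>j\<in>J. x j *\<^sub>R e j)" using span[of xl] by (auto simp: J_def)
  obtain y where y: "yl = (\<Sum>j\<in>J. y j *\<^sub>R e j)" using span[of yl] by (auto simp: J_def)
  have z0: "z0 = t0 *s cvec xl + cvec yl"
    using nz(1) by (simp add: vec_eq_iff cvec_def yl_def xl_def complex_eq_iff)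
  define b where "b = (\<lambda>n j. \<lfloor>real (p n j) * y j\<rfloor>)"
  \<comment> \<open>The correction by 1 prevents divisibility by \<open>p n j\<close>, making the
    pair admissible for transitivity, and disappears in the limit.\<close>
  define a where "a = (\<lambda>n j. \<lfloor>real (p n j) * x j\<rfloor> + (if int (p n j) dvd \<lfloor>real (p n j) * x j\<rfloor> then 1 else 0))"
  have a_ndvd: "\<not> int (p n j) dvd a n j" for n j
  proof
    assume "int (p n j) dvd a n j"
    then have "int (p n j) dvd 1"
      by (auto simp: a_def dvd_add_right_iff split: if_splits)
    then show False using prime_p[of n j] by (auto simp: prime_nat_iff)
  qed
  have a_lim: "(\<lambda>n. of_int (a n j) / real (p n j)) \<longlonglongrightarrow> x j" for j
    by (rule tendsto_ratio[OF p_top, where c = 2]) (auto simp: a_def abs_le_iff; linarith)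
  have b_lim: "(\<lambda>n. of_int (b n j) / real (p n j)) \<longlonglongrightarrow> y j" for j
    by (rule tendsto_ratio[OF p_top, where c = 2]) (auto simp: b_def abs_le_iff; linarith)
  define tv where "tv = (\<lambda>n a. \<Sum>j\<in>J. (of_int (a j) / real (p n j)) *\<^sub>R e j)"
  have tv: "torsion_points.tvec e (p n) J = tv n" for n
    by (simp add: tv_def torsion_points.tvec_def[OF tp] fun_eq_iff)
  have "(\<lambda>n. t0 *s cvec (tv n (a n)) + cvec (tv n (b n))) \<longlonglongrightarrow> z0"
    unfolding z0 x y tv_def cvec_def vector_scalar_mult_def
    by (intro tendsto_intros a_lim b_lim)
  then have "(\<lambda>n. \<phi> t0 (t0 *s cvec (tv n (a n)) + cvec (tv n (b n)))) \<longlonglongrightarrow> \<phi> t0 z0"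
    by (rule isCont_tendsto_compose[OF holomorphic_on_H_continuous[OF holo nz(1)]])
  then have ev_nz: "eventually (\<lambda>n. \<phi> t0 (t0 *s cvec (tv n (a n)) + cvec (tv n (b n))) \<noteq> 0) sequentially"
    by (rule tendsto_imp_eventually_ne) (use nz in auto)

  \<comment> \<open>Scaling by \<open>1 / sqrt (d j)\<close> lets every coordinate contribute at
    most \<open>s\<close> to \<open>r\<close>.\<close>
  define c where "c = (\<lambda>j. s / sqrt (d j))"
  \<comment> \<open>The \<open>- 1\<close> absorbs the \<open>A j + 1\<close> in \<open>r\<close>,
    so that \<open>r \<le> s * l\<close> holds for each \<open>n\<close> and not only in the
    limit.\<close>
  define A where "A = (\<lambda>n j. \<lfloor>real (p n j) * c j\<rfloor> - 1)"
  have sd: "sqrt (d j) \<ge> 1" if "j \<in> J" for j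
    using d[of j] that by (simp add: J_def)
  have c0: "0 < c j" "c j \<le> 1/2" if "j \<in> J" for j
  proof -
    show "0 < c j" using sd[OF that] s by (simp add: c_def)
    have "c j \<le> s / 1" unfolding c_def using sd[OF that] s by (intro divide_left_mono) auto
    then show "c j \<le> 1/2" using s by simp
  qed
  have A_lim: "(\<lambda>n. of_int (A n j) / real (p n j)) \<longlonglongrightarrow> c j" for j
    by (rule tendsto_ratio[OF p_top, where c = 2]) (auto simp: A_def abs_le_iff; linarith)
  have ev_A: "eventually (\<lambda>n. \<forall>j\<in>J. A n j \<ge> 0) sequentially"
  proof (rule eventually_ball_finite)
    show "\<forall>j\<in>J. eventually (\<lambda>n. A n j \<ge> 0) sequentially"
    proof
      fix j assume j: "j \<in> J"
      have "eventually (\<lambda>n. of_int (A n j) / real (p n j) > 0) sequentially"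
        using order_tendstoD(1)[OF A_lim c0(1)[OF j]] .
      then show "eventually (\<lambda>n. A n j \<ge> 0) sequentially"
        by eventually_elim (use p0 in \<open>auto simp: zero_less_divide_iff\<close>)
    qed
  qed (simp add: J_def)
  have "eventually (\<lambda>n. 2 * sqrt 3 * pi * (real m * (1 - s * real l / 2)\<^sup>2)
      * (\<Prod>j\<in>J. 2 * of_int (A n j) / real (p n j)) \<le> of_int k) sequentially"
    using ev_nz ev_A
  proof eventually_elim
    case (elim n)
    interpret torsion_points L \<phi> k m e "p n" J by (rule tp)
    have nzn: "nonvanishing (a n) (b n)"
      unfolding nonvanishing_def F_def torus_fun_def tv
      using elim(1) nz(1) by (intro exI[of _ t0]) simp
    define r where "r = (\<Sum>j\<in>J. sqrt (d j) * (of_int (A n j + 1) / real (p n j)))"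
    have Ac: "of_int (A n j + 1) \<le> real (p n j) * c j" for j
      by (simp add: A_def)
    have "r \<le> (\<Sum>j\<in>J. s)"
      unfolding r_def
    proof (rule sum_mono)
      fix j assume j: "j \<in> J"
      have "of_int (A n j + 1) / real (p n j) \<le> c j"
        using Ac[of j] p0[of n j] by (simp only: pos_divide_le_eq mult.commute)
      then have "sqrt (d j) * (of_int (A n j + 1) / real (p n j)) \<le> sqrt (d j) * c j"
        by (rule mult_left_mono) simp
      also have "\<dots> = s" using sd[OF j] by (simp add: c_def)
      finally show "sqrt (d j) * (of_int (A n j + 1) / real (p n j)) \<le> s" .
    qed
    then have r: "r \<le> s * real l" by (simp add: J_def mult.commute)
    have "2 * A n j < int (p n j)" if j: "j \<in> J" for j
    proof -
      have "real (p n j) * c j \<le> real (p n j) * (1/2)"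
        using c0[OF j] by (intro mult_left_mono) auto
      then have "real_of_int (2 * A n j) < real_of_int (int (p n j))"
        using Ac[of j] by simp
      then show ?thesis by (simp only: of_int_less_iff)
    qed
    then have bound: "2 * sqrt 3 * pi * (real m * (1 - r / 2)\<^sup>2) * (\<Prod>j\<in>J. 2 * of_int (A n j) / real (p n j)) \<le> of_int k"
      using r s elim(2) orth a_ndvd
      by (intro box_weight_bound[OF k nzn _ exp low, where d = d]) (auto simp: J_def r_def)
    have "(1 - s * real l / 2)\<^sup>2 \<le> (1 - r / 2)\<^sup>2"
      using r s by (intro power_mono) auto
    then have "2 * sqrt 3 * pi * (real m * (1 - s * real l / 2)\<^sup>2) * (\<Prod>j\<in>J. 2 * of_int (A n j) / real (p n j))
      \<le> 2 * sqrt 3 * pi * (real m * (1 - r / 2)\<^sup>2) * (\<Prod>j\<in>J. 2 * of_int (A n j) / real (p n j))"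
      using elim(2) by (intro mult_right_mono mult_left_mono prod_nonneg) auto
    then show ?case using bound by linarith
  qed
  moreover have "(\<lambda>n. 2 * sqrt 3 * pi * (real m * (1 - s * real l / 2)\<^sup>2)
      * (\<Prod>j\<in>J. 2 * (of_int (A n j) / real (p n j))))
      \<longlonglongrightarrow> 2 * sqrt 3 * pi * (real m * (1 - s * real l / 2)\<^sup>2) * (\<Prod>j\<in>J. 2 * c j)"
    by (intro tendsto_intros A_lim)
  ultimately have "2 * sqrt 3 * pi * (real m * (1 - s * real l / 2)\<^sup>2) * (\<Prod>j\<in>J. 2 * c j) \<le> of_int k"
    by (intro tendsto_upperbound[of _ _ sequentially]) auto
  then show ?thesis unfolding J_def c_def .
qed

section \<open>Numerical comparison of the constants\<close>

lemma quadratic_le_two_power: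
  fixes l :: nat
  assumes "l \<ge> 3"
  shows "l * l + 4 \<le> 2 ^ l + 2 * l"
  using assms
proof (induction l rule: dec_induct)
  case (step n)
  have "4 * n \<le> n * n + 5"
  proof (cases "n = 3")
    case False
    then have "4 * n \<le> n * n" using step by (intro mult_right_mono) auto
    then show ?thesis by linarith
  qed simp
  then show ?case using step by simp
qed simp

lemma Suc_le_two_power:
  fixes l :: nat
  assumes "l \<ge> 3"
  shows "l + 1 \<le> 2 ^ (l - 1)"
  using assms
proof (induction l rule: dec_induct)
  case (step n)
  then show ?case by (cases n) auto
qed simp

text \<open>For \<open>l \<ge> 3\<close> crude estimates suffice: the square is at least
  \<open>1/4\<close>, \<open>2 / (l+1) \<ge> 2 / 2 ^ (l-1)\<close>, and
  \<open>2 ^ l \<ge> (l-2) l + 4\<close>. The cases \<open>l = 1\<close> and \<open>l = 2\<close>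
  are computed.\<close>

lemma slope_constant_bound:
  fixes l :: nat
  assumes "l \<ge> 1"
  shows "24 / 2 ^ 2 ^ l \<le> 2 * sqrt 3 * pi * (1 - 1 / real (l + 1) * real l / 2)\<^sup>2 * (2 / real (l + 1)) ^ l"
proof -
  have s3: "sqrt 3 \<ge> 173/100" by (rule real_le_rsqrt) (simp add: power2_eq_square)
  have "173/100 * (314/100) \<le> sqrt 3 * pi"
    using s3 pi_approx by (intro mult_mono) auto
  \<comment> \<open>The bound is tight at \<open>l = 1\<close>, where a factor of at least
    \<open>32/3\<close> is required; \<open>54/5\<close> lies between that and
    \<open>2 sqrt 3 pi\<close>.\<close>
  then have "54/5 \<le> 2 * (sqrt 3 * pi)" by linarith
  then have c: "54/5 \<le> 2 * sqrt 3 * pi" by (simp only: mult.assoc)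
  define V where "V = (1 - 1 / real (l + 1) * real l / 2)\<^sup>2 * (2 / real (l + 1)) ^ l"
  have "24 / 2 ^ 2 ^ l \<le> 54/5 * V"
  proof (cases "l \<ge> 3")
    case True
    have "1 / real (l + 1) * real l / 2 \<le> 1/2" by (simp add: field_simps)
    then have "(1/2)\<^sup>2 \<le> (1 - 1 / real (l + 1) * real l / 2)\<^sup>2" by (intro power_mono) auto
    then have V: "(1/2)\<^sup>2 * (2 / real (l + 1)) ^ l \<le> V"
      unfolding V_def by (intro mult_right_mono) auto
    have "real (l + 1) \<le> 2 ^ (l - 1)"
      using Suc_le_two_power[OF True] by (metis of_nat_le_iff of_nat_numeral of_nat_power)
    then have "2 / 2 ^ (l - 1) \<le> 2 / real (l + 1)" by (intro divide_left_mono) auto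
    moreover have "2 / 2 ^ (l - 1) = 1 / (2::real) ^ (l - 2)"
      using True by (simp add: power_diff field_simps power2_eq_square)
    ultimately have "(1 / 2 ^ (l - 2)) ^ l \<le> (2 / real (l + 1)) ^ l" by (intro power_mono) auto
    moreover have "(1 / 2 ^ (l - 2)) ^ l = 1 / (2::real) ^ ((l - 2) * l)"
      by (simp add: power_divide power_mult)
    moreover have "(2::real) ^ ((l - 2) * l + 4) \<le> 2 ^ 2 ^ l"
    proof (rule power_increasing)
      show "(l - 2) * l + 4 \<le> 2 ^ l"
        using quadratic_le_two_power[OF True] True by (simp add: diff_mult_distrib)
    qed simp
    then have "24 / 2 ^ 2 ^ l \<le> 24 / (2::real) ^ ((l - 2) * l + 4)"
      by (intro divide_left_mono) auto
    moreover have "24 / (2::real) ^ ((l - 2) * l + 4) = 3/2 * (1 / 2 ^ ((l - 2) * l))"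
      by (simp add: power_add)
    ultimately have "24 / 2 ^ 2 ^ l \<le> 3/2 * (2 / real (l + 1)) ^ l" by linarith
    also have "\<dots> \<le> 27/10 * (2 / real (l + 1)) ^ l" by (intro mult_right_mono) auto
    also have "\<dots> = 54/5 * ((1/2)\<^sup>2 * (2 / real (l + 1)) ^ l)" by (simp add: power2_eq_square)
    also have "\<dots> \<le> 54/5 * V" using V by (intro mult_left_mono) auto
    finally show ?thesis .
  next
    case False
    then have "l = 1 \<or> l = 2" using assms by auto
    then show ?thesis by (auto simp: V_def power2_eq_square)
  qed
  also have "\<dots> \<le> 2 * sqrt 3 * pi * V"
    using c by (rule mult_right_mono) (simp add: V_def)
  finally show ?thesis by (simp add: V_def mult.assoc)
qed

section \<open>Orthogonal vectors in the lattice\<close>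

lemma full_lattice_combination:
  assumes "full_lattice L" "finite I" "\<And>j. j \<in> I \<Longrightarrow> e j \<in> L"
  shows "(\<Sum>j\<in>I. of_int (n j) *\<^sub>R e j) \<in> L"
proof -
  obtain B where B: "L = range (\<lambda>c :: _ \<Rightarrow> int. \<Sum>b\<in>B. of_int (c b) *\<^sub>R b)"
    using assms(1) unfolding full_lattice_def by blast
  have "\<forall>j\<in>I. \<exists>c :: _ \<Rightarrow> int. e j = (\<Sum>b\<in>B. of_int (c b) *\<^sub>R b)"
    using assms(3) unfolding B by blast
  then obtain c where c: "\<And>j. j \<in> I \<Longrightarrow> e j = (\<Sum>b\<in>B. of_int (c j b) *\<^sub>R b)"
    by metis
  have "(\<Sum>j\<in>I. of_int (n j) *\<^sub>R e j) = (\<Sum>j\<in>I. \<Sum>b\<in>B. of_int (n j * c j b) *\<^sub>R b)"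
    by (rule sum.cong) (auto simp: c scaleR_sum_right)
  also have "\<dots> = (\<Sum>b\<in>B. of_int (\<Sum>j\<in>I. n j * c j b) *\<^sub>R b)"
    by (subst sum.swap) (simp add: scaleR_sum_left)
  finally show ?thesis
    unfolding B by (intro image_eqI[where x = "\<lambda>b. \<Sum>j\<in>I. n j * c j b"]) auto
qed

lemma orthogonal_family_spans:
  fixes e :: "nat \<Rightarrow> real ^ 'n"
  assumes orth: "\<And>i j. i \<in> {1..l} \<Longrightarrow> j \<in> {1..l} \<Longrightarrow> i \<noteq> j \<Longrightarrow> e i \<bullet> e j = 0"
    and nz: "\<And>j. j \<in> {1..l} \<Longrightarrow> e j \<noteq> 0" and l: "l = CARD('n)"
  shows "\<exists>c. x = (\<Sum>j=1..l. c j *\<^sub>R e j)"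
proof -
  have inj: "inj_on e {1..l}"
    using orth nz by (metis inj_onI inner_eq_zero_iff)
  have "pairwise orthogonal (e ` {1..l})"
    unfolding pairwise_def orthogonal_def using orth by blast
  moreover have "0 \<notin> e ` {1..l}" using nz by force
  ultimately have "independent (e ` {1..l})"
    by (rule pairwise_orthogonal_independent)
  then have "UNIV \<subseteq> span (e ` {1..l})"
    using inj l by (intro card_ge_dim_independent) (auto simp: card_image)
  then have "x \<in> range (\<lambda>u. \<Sum>v\<in>e ` {1..l}. u v *\<^sub>R v)"
    by (subst span_finite[symmetric]) auto
  then obtain u where "x = (\<Sum>v\<in>e ` {1..l}. u v *\<^sub>R v)" by blast
  then have "x = (\<Sum>j=1..l. u (e j) *\<^sub>R e j)"
    using inj by (simp add: sum.reindex)
  then show ?thesis by (rule exI[where x = "\<lambda>j. u (e j)"])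
qed

text \<open>The images of the standard unit vectors under the isometric embedding serve as
  \<open>e\<close>.\<close>

lemma contains_A1_sum_orthogonal:
  assumes "contains_A1_sum L l d"
  obtains e where "\<And>j. j \<in> {1..l} \<Longrightarrow> e j \<in> L"
    and "\<And>i j. i \<in> {1..l} \<Longrightarrow> j \<in> {1..l} \<Longrightarrow> e i \<bullet> e j = (if i = j then 2 * real (d j) else 0)"
proof -
  obtain M h where M: "M \<subseteq> L" and h: "bij_betw h (A1_sum_carrier l) M"
    and form: "\<And>x y. x \<in> A1_sum_carrier l \<Longrightarrow> y \<in> A1_sum_carrier l \<Longrightarrow>
        h x \<bullet> h y = of_int (A1_sum_form l d x y)"
    using assms unfolding contains_A1_sum_def by blast
  define u where "u = (\<lambda>j i :: nat. if i = j then 1 else 0 :: int)"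
  have u: "u j \<in> A1_sum_carrier l" if "j \<in> {1..l}" for j
    using that by (auto simp: u_def A1_sum_carrier_def)
  have uform: "A1_sum_form l d (u i) (u j) = (if i = j then 2 * int (d j) else 0)"
    if "i \<in> {1..l}" "j \<in> {1..l}" for i j
    using that unfolding A1_sum_form_def A1_form_def u_def
    by (simp add: if_distrib[of "\<lambda>x. _ * x"] cong: if_cong)
  show ?thesis
  proof
    show "h (u j) \<in> L" if "j \<in> {1..l}" for j
      using u[OF that] h M by (auto simp: bij_betw_def)
    show "h (u i) \<bullet> h (u j) = (if i = j then 2 * real (d j) else 0)"
      if "i \<in> {1..l}" "j \<in> {1..l}" for i j
      unfolding form[OF u[OF that(1)] u[OF that(2)]] uform[OF that] by simp
  qed
qed

theorem theorem5p7:
  fixes L :: "(real ^ 'n) set" and l :: nat and d :: "nat \<Rightarrow> nat"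
  assumes "even_lattice L" and "l = CARD('n)"
    and "\<And>j. 1 \<le> j \<Longrightarrow> j \<le> l \<Longrightarrow> d j > 0"
    and "\<And>i j. 1 \<le> i \<Longrightarrow> i < j \<Longrightarrow> j \<le> l \<Longrightarrow> d i \<le> d j"
    and "contains_A1_sum L l d"
  shows "minimal_slope L \<ge>
    ereal (3 * 2 powi (3 - 2 ^ l) * (\<Prod>j=1..l. real (d j) powi (- (2 ^ (j - 1)))))"
proof -
  define R where "R = 3 * 2 powi (3 - 2 ^ l) * (\<Prod>j=1..l. real (d j) powi (- (2 ^ (j - 1))))"
  have l1: "l \<ge> 1" using assms(2) by (simp add: Suc_le_eq)
  have d: "d j > 0" if "j \<in> {1..l}" for j using assms(3) that by auto
  obtain e where eL: "\<And>j. j \<in> {1..l} \<Longrightarrow> e j \<in> L"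
    and orth: "\<And>i j. i \<in> {1..l} \<Longrightarrow> j \<in> {1..l} \<Longrightarrow> e i \<bullet> e j = (if i = j then 2 * real (d j) else 0)"
    using contains_A1_sum_orthogonal[OF assms(5)] by metis
  have span: "\<exists>c. x = (\<Sum>j=1..l. c j *\<^sub>R e j)" for x
  proof (rule orthogonal_family_spans[OF _ _ assms(2)])
    show "e j \<noteq> 0" if "j \<in> {1..l}" for j
      using orth[OF that that] d[OF that] by auto
  qed (use orth in auto)
  have comb: "(\<Sum>j=1..l. of_int (n j) *\<^sub>R e j) \<in> L" for n :: "nat \<Rightarrow> int"
    using assms(1) eL by (intro full_lattice_combination) (auto simp: even_lattice_def)
  \<comment> \<open>This value meets the three constraints on \<open>s\<close> for every
    \<open>l \<ge> 1\<close>.\<close>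
  define s where "s = 1 / real (l + 1)"
  have s: "s > 0" "s * real l \<le> 1" "s \<le> 1/2" using l1 by (auto simp: s_def field_simps)
  define c where "c = 2 * sqrt 3 * pi * (1 - s * real l / 2)\<^sup>2 * (\<Prod>j=1..l. 2 * (s / sqrt (d j)))"
  have "R \<le> c"
  proof -
    have "(2::real) powi (2 ^ l) = 2 ^ 2 ^ l"
      by (metis of_nat_numeral of_nat_power power_int_of_nat)
    then have pw: "(2::real) powi (3 - 2 ^ l) = 8 / 2 ^ 2 ^ l"
      by (simp add: power_int_diff)
    \<comment> \<open>The box costs only \<open>1 / sqrt (d j)\<close> per coordinate, which is
      weaker than the stated power because \<open>d j \<ge> 1\<close>.\<close>
    have "(\<Prod>j=1..l. real (d j) powi (- (2 ^ (j - 1)))) \<le> (\<Prod>j=1..l. 1 / sqrt (d j))"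
    proof (intro prod_mono conjI)
      fix j assume j: "j \<in> {1..l}"
      have d1: "real (d j) \<ge> 1" using d[OF j] by simp
      have "sqrt (d j) * 1 \<le> sqrt (d j) * sqrt (d j)"
        using d1 by (intro mult_left_mono) auto
      also have "\<dots> = real (d j) ^ 1" by simp
      also have "\<dots> \<le> real (d j) ^ (2 ^ (j - 1))" using d1 by (intro power_increasing) auto
      finally have "sqrt (d j) \<le> real (d j) ^ (2 ^ (j - 1))" by simp
      then have "1 / real (d j) ^ (2 ^ (j - 1)) \<le> 1 / sqrt (d j)"
        using d1 by (intro divide_left_mono mult_pos_pos) auto
      moreover have "real (d j) powi (- (2 ^ (j - 1))) = 1 / real (d j) ^ (2 ^ (j - 1))"
        by (simp add: power_int_minus power_int_def nat_power_eq divide_inverse power_inverse)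
      ultimately show "real (d j) powi (- (2 ^ (j - 1))) \<le> 1 / sqrt (d j)" by simp
      show "0 \<le> real (d j) powi (- (2 ^ (j - 1)))" by simp
    qed
    then have "R \<le> 3 * (8 / 2 ^ 2 ^ l) * (\<Prod>j=1..l. 1 / sqrt (d j))"
      unfolding R_def pw by (intro mult_left_mono) auto
    also have "\<dots> \<le> 2 * sqrt 3 * pi * (1 - s * real l / 2)\<^sup>2 * (2 * s) ^ l * (\<Prod>j=1..l. 1 / sqrt (d j))"
      using slope_constant_bound[OF l1] by (intro mult_right_mono prod_nonneg) (auto simp: s_def)
    also have "\<dots> = c"
    proof -
      have "(\<Prod>j=1..l. 2 * (s / sqrt (d j))) = (\<Prod>j=1..l. (2 * s) * (1 / sqrt (d j)))" by simp
      also have "\<dots> = (2 * s) ^ l * (\<Prod>j=1..l. 1 / sqrt (d j))"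
        unfolding prod.distrib by simp
      finally show ?thesis by (simp add: c_def)
    qed
    finally show ?thesis .
  qed
  have "ereal R \<le> FJ_slope k \<psi>"
    if k: "k \<ge> 1" and \<psi>: "\<psi> \<in> symmetric_FJ_series k L" and nz: "FJ_nonzero \<psi>" for k \<psi>
  proof (cases "FJ_ord \<psi> = 0")
    case True
    then have "FJ_slope k \<psi> = \<infinity>" by (rule FJ_slope_ord_0[OF k])
    then show ?thesis by (simp only: ereal_less_eq)
  next
    case False
    define m where "m = FJ_ord \<psi>"
    have "\<not> vanishes_on_H (\<psi> m)"
      using nz unfolding m_def FJ_ord_def FJ_nonzero_def by (metis LeastI)
    then obtain t0 z0 where t0: "Im t0 > 0" "\<psi> m t0 z0 \<noteq> 0" by (auto simp: vanishes_on_H_def)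
    have van: "vanishes_on_H (\<psi> n)" if "n < m" for n
      using that not_less_Least unfolding m_def FJ_ord_def by blast
    obtain f where f: "\<And>m. jacobi_expansion L m (\<psi> m) (f m)"
      and sym: "\<And>m n v. v \<in> dual_lattice L \<Longrightarrow> f m n v = f n m v"
      using \<psi> unfolding symmetric_FJ_series_def by blast
    \<comment> \<open>Symmetry moves the vanishing of \<open>\<psi> n\<close> for
      \<open>n < m\<close> to row \<open>n\<close> of the expansion of
      \<open>\<psi> m\<close>.\<close>
    have low: "((\<lambda>v. f m n v * exp (2 * of_real pi * \<i> * cform (cvec v) z)) has_sum 0) (dual_lattice L)"
      if "n < m" for n z
    proof (rule has_sum_cong[THEN iffD1, rotated])
      show "((\<lambda>v. f n m v * exp (2 * of_real pi * \<i> * cform (cvec v) z)) has_sum 0) (dual_lattice L)"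
        by (rule jacobi_expansion_vanishing[OF f van[OF that]])
    qed (simp add: sym)
    have "\<psi> m \<in> jacobi_forms k L m"
      using \<psi> unfolding symmetric_FJ_series_def invariant_jacobi_forms_def by blast
    then have "2 * sqrt 3 * pi * (real m * (1 - s * real l / 2)\<^sup>2) * (\<Prod>j=1..l. 2 * (s / sqrt (d j))) \<le> of_int k"
      using k
      by (intro fourier_jacobi_weight_bound[OF _ _ _ f low t0 _ l1 comb span orth d s])
        (auto simp: jacobi_forms_def)
    then have "c * real m \<le> of_int k" by (simp add: c_def mult_ac)
    moreover have "R * real m \<le> c * real m" using \<open>R \<le> c\<close> by (intro mult_right_mono) auto
    ultimately have "R * real m \<le> of_int k" by linarith
    then have "R \<le> of_int k / real m"
      using False by (simp add: m_def field_simps)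
    then show ?thesis using False by (simp add: FJ_slope_def m_def)
  qed
  then show ?thesis
    unfolding minimal_slope_def R_def[symmetric] by (auto intro!: Inf_greatest)
qed

end
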